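(* Let $f^\circ=\mathbb 1_{[0,1)}$, $R>0$, let $1/2<s_\star<s^\star$ and let $\mathcal A$ be a set of strictly positive, non-increasing sequences bounded by $1$ with $\{(j^{-s})_{j\in\mathbb N}:s\in[s_\star,s^\star]\}\subseteq\mathcal A$. Assume $|\varphi_j|\sim j^{-p}$ for some $p>1/2$. Then for every $\alpha\in(0,1)$ there exist $n_\circ\in\mathbb N$ and $\underline A_\alpha\in(0,\infty)$ such that for all $n\ge n_\circ$ and $A\in[0,\underline A_\alpha]$, $$\inf_\Delta\sup_{a\in\mathcal A}\mathcal R\big(\Delta\mid\mathcal E_a^R,A\rho_a(\delta n)\big)\ge1-\alpha,\qquad\delta:=(\log\log n\vee1)^{-1/2},$$ the infimum being over all tests $\Delta$.
   Context: Identify the circle with $[0,1)$. $L^2:=L^2([0,1))$ is the space of square-integrable complex-valued functions on $[0,1)$ with $\langle h_1,h_2\rangle=\int_0^1h_1\overline{h_2}$ and norm $\|\cdot\|_{L^2}$. $e_j(x):=\exp(-\mathrm i2\pi jx)$, $h_j:=\langle h,e_j\rangle$ for $j\in\mathbb Z$. $\mathcal D$ is the set of real-valued probability densities on $[0,1)$ in $L^2$. Circular convolution $(f\circledast\varphi)(y)=\int_0^1f(y-s-\lfloor y-s\rfloor)\varphi(s)ds$. The error density $\varphi\in\mathcal D$ is fixed with $|\varphi_j|>0$ for all $j\in\mathbb Z$; $|\varphi_j|\sim j^{-p}$ means there are constants $0<c\le C$ with $cj^{-p}\le|\varphi_j|\le Cj^{-p}$ for all $j\in\mathbb N$ (recall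 $|\varphi_{-j}|=|\varphi_j|$). For $f\in\mathcal D$, $Y_1,\dots,Y_n$ i.i.d. with density $f\circledast\varphi$, joint law $\mathbb P_f$; a test is a measurable $\{0,1\}$-valued function of $(Y_1,\dots,Y_n)$. $[k]:=\{1,\dots,k\}$, $\nu_k:=(\sum_{|j|\in[k]}|\varphi_j|^{-4})^{1/4}$. $\rho_a(x):=\big(\min_{k\in\mathbb N}(a_k^2\vee\nu_k^2/x)\big)^{1/2}$ for $x>0$. $\mathcal E_a^R:=\{h\in L^2:2\sum_{j\in\mathbb N}a_j^{-2}|h_j|^2\le R^2\}$. Risk: $\mathcal R(\Delta\mid\mathcal E,\rho):=\mathbb P_{f^\circ}(\Delta=1)+\sup\{\mathbb P_f(\Delta=0):f\in\mathcal D,f-f^\circ\in\mathcal E,\|f-f^\circ\|_{L^2}\ge\rho\}$. *)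

theory Defs
  imports "HOL-Probability.Probability"
begin

text \<open>The circle identified with [0,1), with Lebesgue measure.\<close>
definition LI :: "real measure" where
  "LI = restrict_space lborel {0..<1}"

definition fcoeff :: "(real \<Rightarrow> complex) \<Rightarrow> int \<Rightarrow> complex" where
  "fcoeff h j = (LINT x|LI. h x * cis (2 * pi * of_int j * x))"

definition in_L2 :: "(real \<Rightarrow> complex) \<Rightarrow> bool" where
  "in_L2 h \<longleftrightarrow> h \<in> borel_measurable LI \<and> integrable LI (\<lambda>x. (cmod (h x))\<^sup>2)"

definition L2norm :: "(real \<Rightarrow> complex) \<Rightarrow> real" where
  "L2norm h = sqrt (LINT x|LI. (cmod (h x))\<^sup>2)"

definition cpx :: "(real \<Rightarrow> real) \<Rightarrow> real \<Rightarrow> complex" where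
  "cpx f = (\<lambda>x. complex_of_real (f x))"

definition densities :: "(real \<Rightarrow> real) set" where
  "densities = {f. in_L2 (cpx f) \<and> (\<forall>x\<in>{0..<1}. 0 \<le> f x) \<and> (LINT x|LI. f x) = 1}"

definition circ_conv :: "(real \<Rightarrow> real) \<Rightarrow> (real \<Rightarrow> real) \<Rightarrow> real \<Rightarrow> real" where
  "circ_conv f \<phi> y = (LINT s|LI. f (y - s - of_int \<lfloor>y - s\<rfloor>) * \<phi> s)"

definition obs_law :: "(real \<Rightarrow> real) \<Rightarrow> (real \<Rightarrow> real) \<Rightarrow> real measure" where
  "obs_law \<phi> f = density LI (\<lambda>y. ennreal (circ_conv f \<phi> y))"

definition sample_law :: "nat \<Rightarrow> (real \<Rightarrow> real) \<Rightarrow> (real \<Rightarrow> real) \<Rightarrow> (nat \<Rightarrow> real) measure" where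
  "sample_law n \<phi> f = PiM {..<n} (\<lambda>_. obs_law \<phi> f)"

text \<open>Tests: measurable {0,1}-valued functions of (Y_1,...,Y_n); True encodes 1.\<close>
definition tests :: "nat \<Rightarrow> ((nat \<Rightarrow> real) \<Rightarrow> bool) set" where
  "tests n = {\<Delta>. \<Delta> \<in> PiM {..<n} (\<lambda>_. LI) \<rightarrow>\<^sub>M count_space UNIV}"

definition prob_reject :: "nat \<Rightarrow> (real \<Rightarrow> real) \<Rightarrow> (real \<Rightarrow> real) \<Rightarrow> ((nat \<Rightarrow> real) \<Rightarrow> bool) \<Rightarrow> ennreal" where
  "prob_reject n \<phi> f \<Delta> = emeasure (sample_law n \<phi> f) {\<omega> \<in> space (sample_law n \<phi> f). \<Delta> \<omega>}"

definition prob_accept :: "nat \<Rightarrow> (real \<Rightarrow> real) \<Rightarrow> (real \<Rightarrow> real) \<Rightarrow> ((nat \<Rightarrow> real) \<Rightarrow> bool) \<Rightarrow> ennreal" where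
  "prob_accept n \<phi> f \<Delta> = emeasure (sample_law n \<phi> f) {\<omega> \<in> space (sample_law n \<phi> f). \<not> \<Delta> \<omega>}"

definition f0 :: "real \<Rightarrow> real" where
  "f0 = indicator {0..<1}"

text \<open>Ellipsoid E_a^R (sequences a indexed by j >= 1; a 0 is irrelevant).\<close>
definition ellipsoid :: "(nat \<Rightarrow> real) \<Rightarrow> real \<Rightarrow> (real \<Rightarrow> complex) set" where
  "ellipsoid a R = {h. in_L2 h \<and>
     summable (\<lambda>j. if j = 0 then 0 else (cmod (fcoeff h (int j)))\<^sup>2 / (a j)\<^sup>2) \<and>
     2 * (\<Sum>j. if j = 0 then 0 else (cmod (fcoeff h (int j)))\<^sup>2 / (a j)\<^sup>2) \<le> R\<^sup>2}"

text \<open>Risk R(Delta | E, rho) (sup of empty set = 0 in ennreal).\<close>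
definition risk :: "nat \<Rightarrow> (real \<Rightarrow> real) \<Rightarrow> ((nat \<Rightarrow> real) \<Rightarrow> bool) \<Rightarrow> (real \<Rightarrow> complex) set \<Rightarrow> real \<Rightarrow> ennreal" where
  "risk n \<phi> \<Delta> E \<rho> = prob_reject n \<phi> f0 \<Delta> +
     (SUP f \<in> {f \<in> densities. cpx (\<lambda>x. f x - f0 x) \<in> E \<and> L2norm (cpx (\<lambda>x. f x - f0 x)) \<ge> \<rho>}.
        prob_accept n \<phi> f \<Delta>)"

definition nu :: "(real \<Rightarrow> real) \<Rightarrow> nat \<Rightarrow> real" where
  "nu \<phi> k = (\<Sum>j\<in>{j::int. 1 \<le> \<bar>j\<bar> \<and> \<bar>j\<bar> \<le> int k}. 1 / (cmod (fcoeff (cpx \<phi>) j)) ^ 4) powr (1/4)"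

definition rho :: "(real \<Rightarrow> real) \<Rightarrow> (nat \<Rightarrow> real) \<Rightarrow> real \<Rightarrow> real" where
  "rho \<phi> a x = sqrt (Inf ((\<lambda>k. max ((a k)\<^sup>2) ((nu \<phi> k)\<^sup>2 / x)) ` {1..}))"

definition delta :: "nat \<Rightarrow> real" where
  "delta n = (max (ln (ln (real n))) 1) powr (-1/2)"

end

theory Submission
  imports Defs "HOL-Real_Asymp.Real_Asymp"
begin

text \<open>The uniform density is tested against a uniform mixture over smoothness levels and random signs.
  For a level \<open>s\<close> let \<open>2\<^sup>m\<close> balance the two terms of the rate,
  \<open>2 powr (m (2 s + 2 p + 1/2)) = \<delta> n\<close>, and perturb the uniform density by
  \<open>\<Sum> 2 r \<epsilon>\<^sub>j cos (2 \<pi> j x)\<close> over the dyadic block \<open>2\<^sup>m < j \<le> 2 \<cdot> 2\<^sup>m\<close>, with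
  \<open>r\<^sup>2 \<sim> 2 powr (- m (2 s + 1))\<close>. As \<open>s\<close> runs through the given interval, \<open>m\<close> runs through
  about \<open>log n\<close> integers. Different blocks are orthogonal, also after convolution, so they do not
  contribute to the chi-square divergence of the mixture. Within one block, averaging over the signs
  gives a second moment of at most \<open>exp (const \<cdot> n\<^sup>2 r\<^sup>4 \<Sum> \<bar>\<phi>\<^sub>j\<bar>\<^sup>4) \<le> exp (\<delta>\<^sup>-\<^sup>2 / 2) = sqrt (log n)\<close>,
  which is negligible against the number of blocks.\<close>

subsection \<open>Trigonometric polynomials on the circle\<close>

lemma space_LI [simp]: "space LI = {0..<1}"
  by (simp add: LI_def space_restrict_space)

lemma prob_space_LI: "prob_space LI"
  unfolding LI_def by (rule prob_space_restrict_space) auto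

interpretation LI: prob_space LI
  by (rule prob_space_LI)

lemma measurable_LI: "f \<in> borel_measurable borel \<Longrightarrow> f \<in> borel_measurable LI"
  by (simp add: LI_def measurable_restrict_space1)

lemma integrable_LI_continuous:
  fixes f :: "real \<Rightarrow> 'a :: {banach, second_countable_topology}"
  assumes "continuous_on UNIV f"
  shows "integrable LI f"
proof -
  have "set_integrable lborel {0..1} f"
    using borel_integrable_compact[of "{0..1::real}" f] assms continuous_on_subset
    by (fastforce simp: set_integrable_def)
  hence "set_integrable lborel {0..<1} f"
    by (rule set_integrable_subset) auto
  thus ?thesis
    by (simp add: LI_def integrable_restrict_space set_integrable_def)
qed

lemma LINT_LI_FTC:
  fixes f F :: "real \<Rightarrow> real"
  assumes "\<And>x. (F has_real_derivative f x) (at x)" and "continuous_on UNIV f"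
  shows "(LINT x|LI. f x) = F 1 - F 0"
proof -
  have [measurable]: "f \<in> borel_measurable borel"
    by (rule borel_measurable_continuous_onI) fact
  \<comment> \<open>The half-open and the closed unit interval differ by the null set {1}, which
    gives access to the fundamental theorem on a compact interval.\<close>
  have "AE x in lborel. x \<noteq> (1::real)" by (rule AE_lborel_singleton)
  hence "(LBINT x. indicator {0..<1} x *\<^sub>R f x) = (LBINT x. f x * indicator {0..1} x)"
    by (intro integral_cong_AE) (auto simp: indicator_def)
  also have "\<dots> = F 1 - F 0"
    using assms by (intro integral_FTC_Icc_real) (auto simp: continuous_on_eq_continuous_at)
  finally show ?thesis by (simp add: LI_def integral_restrict_space)
qed

section \<open>Orthogonality of the harmonics\<close>

lemma LINT_LI_cos: "(LINT x|LI. cos (2 * pi * of_int j * x)) = (if j = 0 then 1 else 0)"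
proof (cases "j = 0")
  case False
  have "(LINT x|LI. cos (2 * pi * of_int j * x)) =
        sin (2 * pi * of_int j * 1) / (2 * pi * of_int j) - sin (2 * pi * of_int j * 0) / (2 * pi * of_int j)"
    using False
    by (intro LINT_LI_FTC) (auto intro!: derivative_eq_intros continuous_intros simp: field_simps)
  thus ?thesis using False sin_int_2pin[of j] by simp
qed (simp add: LI.prob_space[simplified])

lemma LINT_LI_sin: "(LINT x|LI. sin (2 * pi * of_int j * x)) = 0"
proof (cases "j = 0")
  case False
  have "(LINT x|LI. sin (2 * pi * of_int j * x)) =
        - cos (2 * pi * of_int j * 1) / (2 * pi * of_int j) - - cos (2 * pi * of_int j * 0) / (2 * pi * of_int j)"
    using False
    by (intro LINT_LI_FTC) (auto intro!: derivative_eq_intros continuous_intros simp: field_simps)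
  thus ?thesis using False cos_int_2pin[of j] by simp
qed simp

text \<open>Cosine and sine coefficients are kept apart because convolution with \<phi> shifts the
  phase: a pure cosine acquires a sine component.\<close>

definition harmonic :: "nat \<Rightarrow> real \<Rightarrow> real \<Rightarrow> real \<Rightarrow> real" where
  "harmonic j u v x = u * cos (2 * pi * real j * x) + v * sin (2 * pi * real j * x)"

definition trig_poly :: "real \<Rightarrow> nat set \<Rightarrow> (nat \<Rightarrow> real) \<Rightarrow> (nat \<Rightarrow> real) \<Rightarrow> real \<Rightarrow> real" where
  "trig_poly c J u v x = c + (\<Sum>j\<in>J. harmonic j (u j) (v j) x)"

lemma continuous_harmonic [continuous_intros]: "continuous_on A (harmonic j u v)"
  unfolding harmonic_def[abs_def] by (intro continuous_intros)

lemma continuous_trig_poly [continuous_intros]: "continuous_on A (trig_poly c J u v)"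
  unfolding trig_poly_def[abs_def] by (intro continuous_intros)

lemma LINT_LI_harmonic:
  assumes "j \<ge> 1"
  shows "(LINT x|LI. harmonic j u v x) = 0"
proof -
  have 1: "integrable LI (\<lambda>x. u * cos (2 * pi * real j * x))"
       "integrable LI (\<lambda>x. v * sin (2 * pi * real j * x))"
    by (intro integrable_LI_continuous continuous_intros)+
  show ?thesis
    using LINT_LI_cos[of "int j"] LINT_LI_sin[of "int j"] assms
    by (simp add: harmonic_def Bochner_Integration.integral_add[OF 1])
qed

text \<open>By the product-to-sum formulas the product has frequencies j - l and j + l only. Since j
  + l > 0, the cosine at frequency j - l = 0 is the only term with nonzero mean.\<close>

lemma LINT_LI_harmonic_mult:
  assumes "j \<ge> 1" "l \<ge> 1"
  shows "(LINT x|LI. harmonic j u v x * harmonic l u' v' x) = (if j = l then (u * u' + v * v') / 2 else 0)"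
proof -
  have eq: "harmonic j u v x * harmonic l u' v' x =
     (u * u' + v * v') / 2 * cos (2 * pi * of_int (int j - int l) * x) +
     (u * u' - v * v') / 2 * cos (2 * pi * of_int (int j + int l) * x) +
     (u * v' + v * u') / 2 * sin (2 * pi * of_int (int j + int l) * x) +
     (v * u' - u * v') / 2 * sin (2 * pi * of_int (int j - int l) * x)" for x
    by (simp add: harmonic_def ring_distribs add_divide_distrib diff_divide_distrib
          left_diff_distrib right_diff_distrib cos_add cos_diff sin_add sin_diff)
  have "(LINT x|LI. harmonic j u v x * harmonic l u' v' x) =
     (LINT x|LI. (u * u' + v * v') / 2 * cos (2 * pi * of_int (int j - int l) * x)) +
     (LINT x|LI. (u * u' - v * v') / 2 * cos (2 * pi * of_int (int j + int l) * x)) +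
     (LINT x|LI. (u * v' + v * u') / 2 * sin (2 * pi * of_int (int j + int l) * x)) +
     (LINT x|LI. (v * u' - u * v') / 2 * sin (2 * pi * of_int (int j - int l) * x))"
    unfolding eq
    by (subst Bochner_Integration.integral_add | rule integrable_LI_continuous continuous_intros refl)+
  also have "\<dots> = (if j = l then (u * u' + v * v') / 2 else 0)"
    using assms by (simp only: integral_mult_right_zero LINT_LI_cos LINT_LI_sin) auto
  finally show ?thesis .
qed

lemma LINT_LI_trig_poly:
  assumes "\<And>j. j \<in> J \<Longrightarrow> j \<ge> 1"
  shows "(LINT x|LI. trig_poly c J u v x) = c"
proof -
  have "(LINT x|LI. trig_poly c J u v x) = c + (\<Sum>j\<in>J. LINT x|LI. harmonic j (u j) (v j) x)"
    unfolding trig_poly_def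
    by (subst Bochner_Integration.integral_add Bochner_Integration.integral_sum |
        rule integrable_LI_continuous continuous_intros)+
       (simp add: LI.prob_space[simplified])
  thus ?thesis using assms by (simp add: LINT_LI_harmonic)
qed

lemma LINT_LI_trig_poly_mult:
  assumes fin: "finite J" "finite J'" and J: "\<And>j. j \<in> J \<Longrightarrow> j \<ge> 1" "\<And>j. j \<in> J' \<Longrightarrow> j \<ge> 1"
  shows "(LINT x|LI. trig_poly c J u v x * trig_poly c' J' u' v' x) =
     c * c' + (\<Sum>j\<in>J \<inter> J'. (u j * u' j + v j * v' j) / 2)"
proof -
  \<comment> \<open>The second polynomial gets constant 0 so that the product of the two constants
    is counted once, inside the first summand.\<close>
  have eq: "trig_poly c J u v x * trig_poly c' J' u' v' x =
     c' * trig_poly c J u v x + c * trig_poly 0 J' u' v' x +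
     (\<Sum>j\<in>J. \<Sum>l\<in>J'. harmonic j (u j) (v j) x * harmonic l (u' l) (v' l) x)" for x
    by (simp add: trig_poly_def ring_distribs sum_product)
  have "(LINT x|LI. trig_poly c J u v x * trig_poly c' J' u' v' x) =
     c' * (LINT x|LI. trig_poly c J u v x) + c * (LINT x|LI. trig_poly 0 J' u' v' x) +
     (\<Sum>j\<in>J. \<Sum>l\<in>J'. LINT x|LI. harmonic j (u j) (v j) x * harmonic l (u' l) (v' l) x)"
    unfolding eq
    by (subst Bochner_Integration.integral_add Bochner_Integration.integral_sum |
        rule integrable_LI_continuous continuous_intros)+ simp
  also have "\<dots> = c * c' + (\<Sum>j\<in>J. \<Sum>l\<in>J'. if j = l then (u j * u' j + v j * v' j) / 2 else 0)"
    using J by (auto simp: LINT_LI_trig_poly LINT_LI_harmonic_mult simp del: One_nat_def intro!: sum.cong)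
  also have "(\<Sum>j\<in>J. \<Sum>l\<in>J'. if j = l then (u j * u' j + v j * v' j) / 2 else 0) =
      (\<Sum>j\<in>J \<inter> J'. (u j * u' j + v j * v' j) / 2)"
    using fin by (simp add: sum.inter_restrict sum.delta)
  finally show ?thesis .
qed

section \<open>Fourier coefficients and circular convolution\<close>

lemma fcoeff_cpx:
  assumes "integrable LI h"
  shows "fcoeff (cpx h) j = Complex (LINT x|LI. h x * cos (2 * pi * of_int j * x))
                                    (LINT x|LI. h x * sin (2 * pi * of_int j * x))"
proof -
  have cis_meas: "(\<lambda>x. cis (2 * pi * of_int j * x)) \<in> borel_measurable LI"
    by (intro borel_measurable_integrable integrable_LI_continuous continuous_intros)
  have int: "integrable LI (\<lambda>x. cpx h x * cis (2 * pi * of_int j * x))"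
  proof (rule Bochner_Integration.integrable_bound[OF assms])
    show "(\<lambda>x. cpx h x * cis (2 * pi * of_int j * x)) \<in> borel_measurable LI"
      using borel_measurable_integrable[OF assms] cis_meas unfolding cpx_def by simp
  qed (simp add: norm_mult cpx_def)
  \<comment> \<open>The coefficient pairs h with the conjugate of e_j, so the exponent is positive
    and the imaginary part is plus the sine integral.\<close>
  show ?thesis
    using integral_Re[OF int] integral_Im[OF int]
    by (intro complex_eqI) (simp_all add: fcoeff_def cpx_def)
qed

lemma fcoeff_uminus:
  assumes "integrable LI h"
  shows "cmod (fcoeff (cpx h) (- j)) = cmod (fcoeff (cpx h) j)"
  by (simp add: fcoeff_cpx[OF assms] cmod_def)

lemma fcoeff_trig_poly:
  assumes "finite J" and "\<And>j. j \<in> J \<Longrightarrow> j \<ge> 1" and "l \<ge> 1"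
  shows "fcoeff (cpx (trig_poly c J u v)) (int l) = (if l \<in> J then Complex (u l / 2) (v l / 2) else 0)"
proof -
  \<comment> \<open>A single cosine or sine at frequency l is itself a trigonometric polynomial on
    {l}, so the orthogonality relation reads off the coefficient.\<close>
  have "(LINT x|LI. trig_poly c J u v x * cos (2 * pi * real l * x)) = (if l \<in> J then u l / 2 else 0)"
       "(LINT x|LI. trig_poly c J u v x * sin (2 * pi * real l * x)) = (if l \<in> J then v l / 2 else 0)"
    using LINT_LI_trig_poly_mult[of J "{l}" c u v 0 "\<lambda>_. 1" "\<lambda>_. 0"]
      LINT_LI_trig_poly_mult[of J "{l}" c u v 0 "\<lambda>_. 0" "\<lambda>_. 1"] assms
    by (auto simp: trig_poly_def[of 0] harmonic_def[of l])
  thus ?thesis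
    by (simp add: fcoeff_cpx integrable_LI_continuous continuous_intros complex_eq_iff)
qed

text \<open>Reduction modulo 1 changes the argument by an integer multiple of the period, after
  which the addition theorem separates y from s.\<close>

lemma harmonic_frac_diff:
  "harmonic j u 0 (y - s - of_int \<lfloor>y - s\<rfloor>) =
     u * cos (2 * pi * real j * y) * cos (2 * pi * real j * s) +
     u * sin (2 * pi * real j * y) * sin (2 * pi * real j * s)"
proof -
  have "cos (2 * pi * real j * (y - s - of_int \<lfloor>y - s\<rfloor>)) =
        cos (2 * pi * real j * (y - s) - 2 * pi * of_int (int j * \<lfloor>y - s\<rfloor>))"
    by (simp add: algebra_simps)
  also have "\<dots> = cos (2 * pi * real j * (y - s))"
    unfolding cos_diff using cos_int_2pin[of "int j * \<lfloor>y - s\<rfloor>"] sin_int_2pin[of "int j * \<lfloor>y - s\<rfloor>"] by simp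
  finally show ?thesis
    by (simp add: harmonic_def right_diff_distrib cos_diff distrib_left)
qed

text \<open>The convolution theorem in real form: each real coefficient \<open>u j\<close> is
  multiplied by the complex number \<phi>_j, whose real and imaginary parts become the cosine and
  sine coefficients. The constant survives because \<phi> has mass 1.\<close>

lemma circ_conv_trig_poly:
  assumes phi: "integrable LI \<phi>" and one: "(LINT x|LI. \<phi> x) = 1"
  shows "circ_conv (trig_poly c J u (\<lambda>_. 0)) \<phi> y =
     trig_poly c J (\<lambda>j. u j * Re (fcoeff (cpx \<phi>) (int j))) (\<lambda>j. u j * Im (fcoeff (cpx \<phi>) (int j))) y"
proof -
  have int: "integrable LI (\<lambda>s. \<phi> s * cos (2 * pi * real j * s))"
            "integrable LI (\<lambda>s. \<phi> s * sin (2 * pi * real j * s))" for j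
    using borel_measurable_integrable[OF phi]
    by (auto intro!: Bochner_Integration.integrable_bound[OF phi] borel_measurable_times
          measurable_LI[of "\<lambda>x. sin (_ x)"] measurable_LI[of "\<lambda>x. cos (_ x)"]
          simp: abs_mult mult_left_le)
  let ?C = "\<lambda>j s. u j * cos (2 * pi * real j * y) * (\<phi> s * cos (2 * pi * real j * s))"
  let ?S = "\<lambda>j s. u j * sin (2 * pi * real j * y) * (\<phi> s * sin (2 * pi * real j * s))"
  have intC: "integrable LI (?C j)" and intS: "integrable LI (?S j)" for j
    using int[of j] by (simp_all only: integrable_mult_right)
  have "circ_conv (trig_poly c J u (\<lambda>_. 0)) \<phi> y = (LINT s|LI. c * \<phi> s + (\<Sum>j\<in>J. ?C j s + ?S j s))"
    unfolding circ_conv_def trig_poly_def harmonic_frac_diff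
    by (intro Bochner_Integration.integral_cong refl)
       (simp add: ring_distribs sum_distrib_left sum_distrib_right mult_ac)
  also have "\<dots> = c + (\<Sum>j\<in>J. (LINT s|LI. ?C j s) + (LINT s|LI. ?S j s))"
    using phi intC intS one
    by (simp only: Bochner_Integration.integral_add Bochner_Integration.integral_sum
          Bochner_Integration.integrable_sum Bochner_Integration.integrable_add
          integrable_mult_right integral_mult_right_zero mult_1_right)
  also have "\<dots> = trig_poly c J (\<lambda>j. u j * Re (fcoeff (cpx \<phi>) (int j))) (\<lambda>j. u j * Im (fcoeff (cpx \<phi>) (int j))) y"
    by (simp add: trig_poly_def harmonic_def fcoeff_cpx[OF phi]) (simp add: mult_ac)
  finally show ?thesis .
qed

subsection \<open>Testing against a mixture\<close>

text \<open>A product measure is determined by its values on rectangles, and there both the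
  indicator and the density factorise over the coordinates. Sigma-finiteness of the factors with
  density is assumed; it holds below because they are probability measures.\<close>

lemma (in product_sigma_finite) PiM_density:
  assumes fin: "finite I" and f: "\<And>i. i \<in> I \<Longrightarrow> f i \<in> borel_measurable (M i)"
    and dens: "product_sigma_finite (\<lambda>i. density (M i) (f i))"
  shows "PiM I (\<lambda>i. density (M i) (f i)) = density (PiM I M) (\<lambda>\<omega>. \<Prod>i\<in>I. f i (\<omega> i))"
proof -
  interpret D: product_sigma_finite "\<lambda>i. density (M i) (f i)" by fact
  note [measurable] = f
  show ?thesis
  proof (rule D.PiM_eqI[OF fin, symmetric])
    show "sets (density (PiM I M) (\<lambda>\<omega>. \<Prod>i\<in>I. f i (\<omega> i))) = sets (PiM I (\<lambda>i. density (M i) (f i)))"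
      by (simp cong: sets_PiM_cong)
  next
    fix A assume "\<And>i. i \<in> I \<Longrightarrow> A i \<in> sets (density (M i) (f i))"
    hence A [measurable]: "\<And>i. i \<in> I \<Longrightarrow> A i \<in> sets (M i)" by simp
    have "emeasure (density (PiM I M) (\<lambda>\<omega>. \<Prod>i\<in>I. f i (\<omega> i))) (Pi\<^sub>E I A) =
        (\<integral>\<^sup>+\<omega>. (\<Prod>i\<in>I. f i (\<omega> i)) * indicator (Pi\<^sub>E I A) \<omega> \<partial>PiM I M)"
      using fin A by (intro emeasure_density) (auto intro!: sets_PiM_I_finite)
    also have "\<dots> = (\<integral>\<^sup>+\<omega>. (\<Prod>i\<in>I. f i (\<omega> i) * indicator (A i) (\<omega> i)) \<partial>PiM I M)"
    proof (intro nn_integral_cong)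
      fix \<omega> assume "\<omega> \<in> space (PiM I M)"
      hence "indicator (Pi\<^sub>E I A) \<omega> = (\<Prod>i\<in>I. indicator (A i) (\<omega> i) :: ennreal)"
        using fin by (auto simp: space_PiM PiE_iff indicator_def prod_zero_iff split: if_splits)
      thus "(\<Prod>i\<in>I. f i (\<omega> i)) * indicator (Pi\<^sub>E I A) \<omega> = (\<Prod>i\<in>I. f i (\<omega> i) * indicator (A i) (\<omega> i))"
        by (simp add: prod.distrib)
    qed
    also have "\<dots> = (\<Prod>i\<in>I. emeasure (density (M i) (f i)) (A i))"
      using fin by (subst product_nn_integral_prod) (auto simp: emeasure_density)
    finally show "emeasure (density (PiM I M) (\<lambda>\<omega>. \<Prod>i\<in>I. f i (\<omega> i))) (Pi\<^sub>E I A) =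
        (\<Prod>i\<in>I. emeasure (density (M i) (f i)) (A i))" .
  qed
qed

text \<open>The average \<open>H\<close> of the likelihood ratios satisfies \<open>\<integral>(H - 1)\<^sup>2 \<le> \<alpha>\<^sup>2\<close>;
  by AM-GM, \<open>\<bar>H - 1\<bar> \<le> (H - 1)\<^sup>2 / (2 \<alpha>) + \<alpha> / 2\<close>, which bounds the total variation by \<open>\<alpha>\<close>.\<close>
lemma (in prob_space) ex_hypothesis_large_error:
  fixes G :: "'i \<Rightarrow> 'a \<Rightarrow> real"
  assumes I: "finite I" "I \<noteq> {}" and \<alpha>: "0 < \<alpha>" and D: "D \<in> events"
    and G: "\<And>i. i \<in> I \<Longrightarrow> integrable M (G i)" "\<And>i. i \<in> I \<Longrightarrow> (\<integral>x. G i x \<partial>M) = 1"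
    and GG: "\<And>i k. i \<in> I \<Longrightarrow> k \<in> I \<Longrightarrow> integrable M (\<lambda>x. G i x * G k x)"
    and chi: "(\<Sum>i\<in>I. \<Sum>k\<in>I. \<integral>x. G i x * G k x \<partial>M) \<le> (1 + \<alpha>\<^sup>2) * (real (card I))\<^sup>2"
  shows "\<exists>i\<in>I. 1 - \<alpha> \<le> prob (space M - D) + (\<integral>x. G i x * indicator D x \<partial>M)"
proof (rule ccontr)
  assume contra: "\<not> ?thesis"
  define N where "N = real (card I)"
  have N: "N > 0" using I by (simp add: N_def card_gt_0_iff)
  define H where "H = (\<lambda>x. (\<Sum>i\<in>I. G i x) / N)"
  have H: "integrable M H" and H1: "(\<integral>x. H x \<partial>M) = 1"
    using G N by (auto simp: H_def N_def)
  have sq: "(H x)\<^sup>2 = (\<Sum>i\<in>I. \<Sum>k\<in>I. G i x * G k x) / N\<^sup>2" for x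
    by (simp add: H_def power2_eq_square sum_product)
  have H2: "integrable M (\<lambda>x. (H x)\<^sup>2)"
    unfolding sq using GG by auto
  have "(\<integral>x. (H x)\<^sup>2 \<partial>M) = (\<Sum>i\<in>I. \<Sum>k\<in>I. \<integral>x. G i x * G k x \<partial>M) / N\<^sup>2"
    unfolding sq using GG by (simp add: Bochner_Integration.integral_sum)
  also have "\<dots> \<le> 1 + \<alpha>\<^sup>2"
    using chi N by (simp add: N_def divide_le_eq)
  finally have H2_le: "(\<integral>x. (H x)\<^sup>2 \<partial>M) \<le> 1 + \<alpha>\<^sup>2" .
  have GD: "integrable M (\<lambda>x. G i x * indicator D x)" if "i \<in> I" for i
    using that G D by (intro integrable_real_mult_indicator)
  have HD: "integrable M (\<lambda>x. H x * indicator D x)"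
    using H D by (intro integrable_real_mult_indicator)
  \<comment> \<open>D plays the acceptance region. If every hypothesis violated the claimed bound,
    averaging over I would make the mean acceptance probability smaller than
    \<open>prob D - \<alpha>\<close>.\<close>
  have "(\<integral>x. H x * indicator D x \<partial>M) = (\<Sum>i\<in>I. \<integral>x. G i x * indicator D x \<partial>M) / N"
    using GD by (simp add: H_def sum_distrib_right)
  also have "\<dots> < (\<Sum>i\<in>I. 1 - \<alpha> - prob (space M - D)) / N"
    using contra I N by (intro divide_strict_right_mono sum_strict_mono) (auto simp: not_le)
  also have "\<dots> = prob D - \<alpha>"
    using N D by (simp add: N_def prob_compl)
  finally have lt: "(\<integral>x. H x * indicator D x \<partial>M) < prob D - \<alpha>" .
  have sqdiff: "(H x - 1)\<^sup>2 = (H x)\<^sup>2 - 2 * H x + 1" for x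
    by (simp add: power2_eq_square algebra_simps)
  have "(\<integral>x. (H x - 1)\<^sup>2 \<partial>M) = (\<integral>x. (H x)\<^sup>2 \<partial>M) - 1"
    unfolding sqdiff using H H2 H1 by (simp add: prob_space)
  also have "\<dots> \<le> \<alpha>\<^sup>2" using H2_le by simp
  finally have var: "(\<integral>x. (H x - 1)\<^sup>2 \<partial>M) \<le> \<alpha>\<^sup>2" .
  have intv: "integrable M (\<lambda>x. (H x - 1)\<^sup>2)"
    unfolding sqdiff using H H2 by simp
  \<comment> \<open>On D this is the expanded square of H - 1 + \<alpha>; off D the left side is at
    most 0 and the right side is 0.\<close>
  have pt: "indicator D x - ((H x - 1)\<^sup>2 / (2 * \<alpha>) + \<alpha> / 2) \<le> H x * indicator D x" for x
  proof -
    have "0 \<le> (H x - 1 + \<alpha>)\<^sup>2 / (2 * \<alpha>)" using \<alpha> by simp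
    also have "(H x - 1 + \<alpha>)\<^sup>2 / (2 * \<alpha>) = (H x - 1)\<^sup>2 / (2 * \<alpha>) + (H x - 1) + \<alpha> / 2"
      using \<alpha> by (simp add: power2_eq_square field_simps)
    finally have "x \<in> D \<Longrightarrow> ?thesis" by simp
    moreover have "0 \<le> (H x - 1)\<^sup>2 / (2 * \<alpha>) + \<alpha> / 2" using \<alpha> by simp
    hence "x \<notin> D \<Longrightarrow> ?thesis"
      by (simp only: indicator_simps if_False mult_zero_right diff_0 neg_le_0_iff_le not_False_eq_True)
    ultimately show ?thesis by blast
  qed
  have "prob D - (\<alpha>\<^sup>2 / (2 * \<alpha>) + \<alpha> / 2) \<le> prob D - ((\<integral>x. (H x - 1)\<^sup>2 \<partial>M) / (2 * \<alpha>) + \<alpha> / 2)"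
    using var \<alpha> by (simp add: divide_right_mono)
  also have "\<dots> = (\<integral>x. indicator D x - ((H x - 1)\<^sup>2 / (2 * \<alpha>) + \<alpha> / 2) \<partial>M)"
    using intv D by (simp add: prob_space less_top[symmetric])
  also have "\<dots> \<le> (\<integral>x. H x * indicator D x \<partial>M)"
    using intv D HD pt by (intro integral_mono) (auto simp: less_top[symmetric])
  finally show False using lt \<alpha> by (simp add: power2_eq_square)
qed

section \<open>Laws of the observations\<close>

lemma densities_integrable:
  assumes "f \<in> densities"
  shows "integrable LI f"
  \<comment> \<open>The integral of a non-integrable function is 0 by convention, so total mass 1
    forces integrability.\<close>
  using assms not_integrable_integral_eq[of LI f] by (auto simp: densities_def)

lemma circ_conv_nonneg:
  assumes "\<And>x. x \<in> {0..<1} \<Longrightarrow> 0 \<le> f x" "\<And>x. x \<in> {0..<1} \<Longrightarrow> 0 \<le> \<phi> x"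
  shows "0 \<le> circ_conv f \<phi> y"
  unfolding circ_conv_def
proof (rule Bochner_Integration.integral_nonneg)
  fix s assume "s \<in> space LI"
  moreover have "y - s - of_int \<lfloor>y - s\<rfloor> \<in> {0..<1}"
    using frac_ge_0[of "y - s"] frac_lt_1[of "y - s"] by (simp add: frac_def)
  ultimately show "0 \<le> f (y - s - of_int \<lfloor>y - s\<rfloor>) * \<phi> s"
    using assms by simp
qed

interpretation LIs: product_prob_space "\<lambda>_::nat. LI" UNIV ..

lemma prob_space_density_LI:
  assumes "continuous_on UNIV T" "\<And>x. x \<in> {0..<1} \<Longrightarrow> 0 \<le> T x" "(LINT x|LI. T x) = 1"
  shows "prob_space (density LI (\<lambda>x. ennreal (T x)))"
proof
  have "emeasure (density LI (\<lambda>x. ennreal (T x))) (space LI) =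
      (\<integral>\<^sup>+x. ennreal (T x) * indicator (space LI) x \<partial>LI)"
    using assms
    by (intro emeasure_density sets.top measurable_compose[OF _ measurable_ennreal] measurable_LI
          borel_measurable_continuous_onI)
  also have "\<dots> = (\<integral>\<^sup>+x. ennreal (T x) \<partial>LI)"
    by (intro nn_integral_cong) simp
  also have "\<dots> = ennreal (LINT x|LI. T x)"
    using assms by (intro nn_integral_eq_integral integrable_LI_continuous) auto
  finally show "emeasure (density LI (\<lambda>x. ennreal (T x))) (space (density LI (\<lambda>x. ennreal (T x)))) = 1"
    using assms by simp
qed

lemma integrable_prod_LI:
  fixes T :: "real \<Rightarrow> real" and n :: nat
  assumes "continuous_on UNIV T"
  shows "integrable (PiM {..<n} (\<lambda>_. LI)) (\<lambda>\<omega>. \<Prod>i<n. T (\<omega> i))"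
  using assms LIs.product_integrable_prod[of "{..<n}" "\<lambda>_. T"] by (simp add: integrable_LI_continuous)

lemma LINT_prod_LI:
  fixes T :: "real \<Rightarrow> real" and n :: nat
  assumes "continuous_on UNIV T"
  shows "(LINT \<omega>|PiM {..<n} (\<lambda>_. LI). (\<Prod>i<n. T (\<omega> i))) = (LINT x|LI. T x) ^ n"
  using assms LIs.product_integral_prod[of "{..<n}" "\<lambda>_. T"] by (simp add: integrable_LI_continuous)

text \<open>Represents probabilities as integrals against the uniform product law, with the product
  of the T-values as likelihood ratio. T is a continuous function that agrees with the convolution
  on the circle.\<close>

lemma emeasure_sample_law:
  assumes T: "continuous_on UNIV T" "\<And>x. x \<in> {0..<1} \<Longrightarrow> 0 \<le> T x" "(LINT x|LI. T x) = 1"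
    and eq: "\<And>y. y \<in> {0..<1} \<Longrightarrow> circ_conv f \<phi> y = T y"
    and E: "E \<in> sets (PiM {..<n} (\<lambda>_. LI))"
  shows "emeasure (sample_law n \<phi> f) E =
    ennreal (LINT \<omega>|PiM {..<n} (\<lambda>_. LI). (\<Prod>i<n. T (\<omega> i)) * indicator E \<omega>)"
proof -
  have T_meas [measurable]: "T \<in> borel_measurable LI"
    using T(1) by (intro measurable_LI borel_measurable_continuous_onI)
  have "(\<integral>\<^sup>+y. ennreal (circ_conv f \<phi> y) * indicator A y \<partial>LI) = (\<integral>\<^sup>+y. ennreal (T y) * indicator A y \<partial>LI)" for A
    by (intro nn_integral_cong) (simp add: eq)
  hence "obs_law \<phi> f = density LI (\<lambda>x. ennreal (T x))"
    unfolding obs_law_def density_def by simp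
  hence "sample_law n \<phi> f = PiM {..<n} (\<lambda>_. density LI (\<lambda>x. ennreal (T x)))"
    by (simp add: sample_law_def)
  also have "\<dots> = density (PiM {..<n} (\<lambda>_. LI)) (\<lambda>\<omega>. \<Prod>i<n. ennreal (T (\<omega> i)))"
    using prob_space_density_LI[OF T]
    by (intro LIs.PiM_density) (auto intro!: product_sigma_finite.intro prob_space_imp_sigma_finite)
  finally have "emeasure (sample_law n \<phi> f) E =
      (\<integral>\<^sup>+\<omega>. (\<Prod>i<n. ennreal (T (\<omega> i))) * indicator E \<omega> \<partial>PiM {..<n} (\<lambda>_. LI))"
    using E by (simp add: emeasure_density)
  also have "\<dots> = (\<integral>\<^sup>+\<omega>. ennreal ((\<Prod>i<n. T (\<omega> i)) * indicator E \<omega>) \<partial>PiM {..<n} (\<lambda>_. LI))"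
  proof (intro nn_integral_cong)
    fix \<omega> assume "\<omega> \<in> space (PiM {..<n} (\<lambda>_. LI))"
    hence "\<And>i. i \<in> {..<n} \<Longrightarrow> 0 \<le> T (\<omega> i)" using T(2) by (auto simp: space_PiM PiE_iff)
    hence "(\<Prod>i<n. ennreal (T (\<omega> i))) = ennreal (\<Prod>i<n. T (\<omega> i))" by (rule prod_ennreal)
    thus "(\<Prod>i<n. ennreal (T (\<omega> i))) * indicator E \<omega> = ennreal ((\<Prod>i<n. T (\<omega> i)) * indicator E \<omega>)"
      by (simp add: indicator_def)
  qed
  also have "\<dots> = ennreal (LINT \<omega>|PiM {..<n} (\<lambda>_. LI). (\<Prod>i<n. T (\<omega> i)) * indicator E \<omega>)"
    using T E by (intro nn_integral_eq_integral integrable_real_mult_indicator integrable_prod_LI AE_I2)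
                 (auto simp: space_PiM PiE_iff intro!: prod_nonneg mult_nonneg_nonneg)
  finally show ?thesis .
qed

subsection \<open>Averaging over random signs\<close>

text \<open>For \<bar>t\<bar> \<le> 1, quadratic bounds on the two exponentials average to 1 + t^2;
  beyond 1, cosh t is at most exp \<bar>t\<bar>. The sharp exponent t^2/2 would only improve
  constants.\<close>

lemma cosh_le_exp_square: "cosh (t::real) \<le> exp (t\<^sup>2)"
proof (cases "\<bar>t\<bar> \<le> 1")
  case True
  define s where "s = \<bar>t\<bar>"
  have s: "0 \<le> s" "s \<le> 1" using True by (simp_all add: s_def)
  have "exp s \<le> 1 + s + s\<^sup>2" using s by (rule exp_bound)
  moreover have "exp (- s) \<le> 1 - s + s\<^sup>2"
  proof -
    have "exp (- s) = 1 / exp s" by (simp add: exp_minus inverse_eq_divide)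
    also have "\<dots> \<le> 1 / (1 + s)" using s by (intro divide_left_mono) auto
    also have "\<dots> \<le> 1 - s + s\<^sup>2"
    proof (subst pos_divide_le_eq)
      have "(1 - s + s\<^sup>2) * (1 + s) = 1 + s ^ 3"
        by (simp add: power2_eq_square power3_eq_cube algebra_simps)
      thus "1 \<le> (1 - s + s\<^sup>2) * (1 + s)" using s by simp
    qed (use s in simp)
    finally show ?thesis .
  qed
  ultimately have "cosh s \<le> 1 + s\<^sup>2" by (simp add: cosh_def)
  also have "\<dots> \<le> exp (s\<^sup>2)" by (rule exp_ge_add_one_self)
  finally show ?thesis by (simp add: s_def)
next
  case False
  have "cosh t = cosh \<bar>t\<bar>" by simp
  also have "\<dots> \<le> exp \<bar>t\<bar>" by (simp add: cosh_def)
  also have "\<dots> \<le> exp (t\<^sup>2)"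
    using False self_le_power[of "\<bar>t\<bar>" 2] by simp
  finally show ?thesis .
qed

text \<open>Independence of the signs: the sum over sign vectors factorises over coordinates. A
  fixed sign \<epsilon>'_j merely permutes {-1, 1}, so each factor is 2 cosh t_j.\<close>

lemma sum_signs_exp_le:
  fixes t \<epsilon>' :: "'j \<Rightarrow> real"
  assumes "finite J" and \<epsilon>': "\<epsilon>' \<in> PiE J (\<lambda>_. {-1, 1})"
  shows "(\<Sum>\<epsilon>\<in>PiE J (\<lambda>_. {-1, 1}). exp (\<Sum>j\<in>J. t j * (\<epsilon> j * \<epsilon>' j))) \<le> 2 ^ card J * exp (\<Sum>j\<in>J. (t j)\<^sup>2)"
proof -
  have "(\<Sum>\<epsilon>\<in>PiE J (\<lambda>_. {-1, 1}). exp (\<Sum>j\<in>J. t j * (\<epsilon> j * \<epsilon>' j))) =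
        (\<Prod>j\<in>J. \<Sum>e\<in>{-1, 1}. exp (t j * (e * \<epsilon>' j)))"
    using assms by (subst prod_sum_PiE) (simp_all add: exp_sum)
  also have "\<dots> = (\<Prod>j\<in>J. 2 * cosh (t j))"
  proof (intro prod.cong refl)
    fix j assume "j \<in> J"
    hence "\<epsilon>' j = -1 \<or> \<epsilon>' j = 1" using \<epsilon>' by (auto simp: PiE_iff)
    thus "(\<Sum>e\<in>{-1, 1}. exp (t j * (e * \<epsilon>' j))) = 2 * cosh (t j)" by (auto simp: cosh_def)
  qed
  also have "\<dots> \<le> (\<Prod>j\<in>J. 2 * exp ((t j)\<^sup>2))"
    by (intro prod_mono) (simp add: cosh_le_exp_square)
  also have "\<dots> = 2 ^ card J * exp (\<Sum>j\<in>J. (t j)\<^sup>2)"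
    using assms by (simp add: prod.distrib exp_sum)
  finally show ?thesis .
qed

lemma card_signs: "finite J \<Longrightarrow> card (PiE J (\<lambda>_. {-1, 1::real})) = 2 ^ card J"
  by (simp add: card_PiE numeral_2_eq_2)

text \<open>Reduces the n-th power to an exponential through 1 + x \<le> exp x. The signs are
  indexed by the larger set J, so that all blocks can share one sign vector.\<close>

lemma sum_signs_power_le:
  fixes w \<epsilon>' :: "'j \<Rightarrow> real"
  assumes J: "finite J" "B \<subseteq> J" and \<epsilon>': "\<epsilon>' \<in> PiE J (\<lambda>_. {-1, 1})"
    and w: "\<And>j. 0 \<le> w j" "(\<Sum>j\<in>B. w j) \<le> 1" "(\<Sum>j\<in>B. (real n * w j)\<^sup>2) \<le> \<tau>"
  shows "(\<Sum>\<epsilon>\<in>PiE J (\<lambda>_. {-1, 1}). (1 + (\<Sum>j\<in>B. w j * (\<epsilon> j * \<epsilon>' j))) ^ n) \<le> 2 ^ card J * exp \<tau>"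
proof -
  \<comment> \<open>Extension by zero: signs outside B contribute the factor 2 cosh 0.\<close>
  define t where "t = (\<lambda>j. if j \<in> B then real n * w j else 0)"
  have "(1 + (\<Sum>j\<in>B. w j * (\<epsilon> j * \<epsilon>' j))) ^ n \<le> exp (\<Sum>j\<in>J. t j * (\<epsilon> j * \<epsilon>' j))"
    if \<epsilon>: "\<epsilon> \<in> PiE J (\<lambda>_. {-1, 1})" for \<epsilon>
  proof -
    let ?x = "\<Sum>j\<in>B. w j * (\<epsilon> j * \<epsilon>' j)"
    \<comment> \<open>The base must be nonnegative before the inequality can be raised to the n-th
      power; this is where total weight at most 1 enters.\<close>
    have "- (\<Sum>j\<in>B. w j) = (\<Sum>j\<in>B. w j * (-1))" by (simp add: sum_negf)
    also have "\<dots> \<le> ?x"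
    proof (intro sum_mono mult_left_mono w)
      fix j assume "j \<in> B"
      hence "\<epsilon> j \<in> {-1, 1}" "\<epsilon>' j \<in> {-1, 1}" using \<epsilon> \<epsilon>' J by (auto simp: PiE_iff)
      thus "-1 \<le> \<epsilon> j * \<epsilon>' j" by auto
    qed
    finally have "0 \<le> 1 + ?x" using w by simp
    hence "(1 + ?x) ^ n \<le> exp ?x ^ n" by (intro power_mono exp_ge_add_one_self)
    also have "\<dots> = exp (\<Sum>j\<in>B. real n * w j * (\<epsilon> j * \<epsilon>' j))"
      by (simp add: exp_of_nat_mult[symmetric] sum_distrib_left mult_ac)
    also have "(\<Sum>j\<in>B. real n * w j * (\<epsilon> j * \<epsilon>' j)) = (\<Sum>j\<in>J. t j * (\<epsilon> j * \<epsilon>' j))"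
      using J by (intro sum.mono_neutral_cong_left) (auto simp: t_def)
    finally show ?thesis .
  qed
  hence "(\<Sum>\<epsilon>\<in>PiE J (\<lambda>_. {-1, 1}). (1 + (\<Sum>j\<in>B. w j * (\<epsilon> j * \<epsilon>' j))) ^ n) \<le>
        (\<Sum>\<epsilon>\<in>PiE J (\<lambda>_. {-1, 1}). exp (\<Sum>j\<in>J. t j * (\<epsilon> j * \<epsilon>' j)))"
    by (rule sum_mono)
  also have "\<dots> \<le> 2 ^ card J * exp (\<Sum>j\<in>J. (t j)\<^sup>2)"
    using J \<epsilon>' by (intro sum_signs_exp_le)
  also have "(\<Sum>j\<in>J. (t j)\<^sup>2) = (\<Sum>j\<in>B. (real n * w j)\<^sup>2)"
    using J by (intro sum.mono_neutral_cong_right) (auto simp: t_def)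
  also have "2 ^ card J * exp \<dots> \<le> 2 ^ card J * exp \<tau>"
    using w by simp
  finally show ?thesis .
qed

text \<open>For different levels the blocks are disjoint and every summand is 1, so only the
  diagonal pairs pay the factor exp \<tau>. Divided by the squared number of hypotheses, the bound
  is 1 + exp \<tau> / card M.\<close>

lemma sum_mixture_le:
  fixes c :: "'m \<Rightarrow> 'm \<Rightarrow> 'j \<Rightarrow> real"
  assumes fin: "finite M" "finite J" and B: "\<And>m. m \<in> M \<Longrightarrow> B m \<subseteq> J"
    and disj: "\<And>m m'. m \<in> M \<Longrightarrow> m' \<in> M \<Longrightarrow> m \<noteq> m' \<Longrightarrow> B m \<inter> B m' = {}"
    and c: "\<And>m j. 0 \<le> c m m j" "\<And>m. m \<in> M \<Longrightarrow> (\<Sum>j\<in>B m. c m m j) \<le> 1"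
      "\<And>m. m \<in> M \<Longrightarrow> (\<Sum>j\<in>B m. (real n * c m m j)\<^sup>2) \<le> \<tau>"
  defines "E \<equiv> PiE J (\<lambda>_. {-1, 1::real})"
  shows "(\<Sum>(m, \<epsilon>)\<in>M \<times> E. \<Sum>(m', \<epsilon>')\<in>M \<times> E.
            (1 + (\<Sum>j\<in>B m \<inter> B m'. c m m' j * (\<epsilon> j * \<epsilon>' j))) ^ n)
         \<le> (2 ^ card J)\<^sup>2 * ((real (card M))\<^sup>2 + real (card M) * exp \<tau>)"
proof -
  define g where "g = (\<lambda>m m' \<epsilon> \<epsilon>'. (1 + (\<Sum>j\<in>B m \<inter> B m'. c m m' j * (\<epsilon> j * \<epsilon>' j))) ^ n)"
  let ?K = "2 ^ card J :: real"
  have cardE: "real (card E) = ?K" using fin by (simp add: E_def card_signs)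
  have g_le: "(\<Sum>\<epsilon>\<in>E. \<Sum>\<epsilon>'\<in>E. g m m' \<epsilon> \<epsilon>') \<le> ?K\<^sup>2 * (1 + (if m = m' then exp \<tau> else 0))"
    if m: "m \<in> M" "m' \<in> M" for m m'
  proof (cases "m = m'")
    case False
    hence "(\<Sum>\<epsilon>\<in>E. \<Sum>\<epsilon>'\<in>E. g m m' \<epsilon> \<epsilon>') = (\<Sum>\<epsilon>\<in>E. \<Sum>\<epsilon>'\<in>E. 1)"
      using disj[OF m] by (simp add: g_def)
    thus ?thesis using False cardE by (simp add: power2_eq_square)
  next
    case True
    have "(\<Sum>\<epsilon>\<in>E. \<Sum>\<epsilon>'\<in>E. g m m' \<epsilon> \<epsilon>') = (\<Sum>\<epsilon>'\<in>E. \<Sum>\<epsilon>\<in>E. g m m \<epsilon> \<epsilon>')"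
      unfolding True by (rule sum.swap)
    also have "\<dots> \<le> (\<Sum>\<epsilon>'\<in>E. ?K * exp \<tau>)"
      unfolding E_def using sum_signs_power_le[OF fin(2) B[OF m(1)] _ c(1) c(2)[OF m(1)] c(3)[OF m(1)]]
      by (intro sum_mono) (simp add: g_def)
    also have "\<dots> = ?K\<^sup>2 * exp \<tau>" using cardE by (simp add: power2_eq_square)
    \<comment> \<open>The extra 1 is slack that puts diagonal and off-diagonal pairs under one
      formula.\<close>
    also have "\<dots> \<le> ?K\<^sup>2 * (1 + exp \<tau>)" by simp
    finally show ?thesis using True by simp
  qed
  have "(\<Sum>(m, \<epsilon>)\<in>M \<times> E. \<Sum>(m', \<epsilon>')\<in>M \<times> E. g m m' \<epsilon> \<epsilon>') =
        (\<Sum>m\<in>M. \<Sum>\<epsilon>\<in>E. \<Sum>m'\<in>M. \<Sum>\<epsilon>'\<in>E. g m m' \<epsilon> \<epsilon>')"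
    by (simp add: sum.cartesian_product[symmetric])
  also have "\<dots> = (\<Sum>m\<in>M. \<Sum>m'\<in>M. \<Sum>\<epsilon>\<in>E. \<Sum>\<epsilon>'\<in>E. g m m' \<epsilon> \<epsilon>')"
    by (intro sum.cong refl sum.swap)
  also have "\<dots> \<le> (\<Sum>m\<in>M. \<Sum>m'\<in>M. ?K\<^sup>2 * (1 + (if m = m' then exp \<tau> else 0)))"
    by (intro sum_mono g_le)
  also have "\<dots> = ?K\<^sup>2 * ((real (card M))\<^sup>2 + real (card M) * exp \<tau>)"
    using fin by (simp add: sum_distrib_left[symmetric] sum.distrib sum.delta power2_eq_square ring_distribs)
  finally show ?thesis by (simp add: g_def)
qed

subsection \<open>Trigonometric alternatives\<close>

lemma fcoeff_cong:
  assumes "\<And>x. x \<in> {0..<1} \<Longrightarrow> g x = h x"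
  shows "fcoeff g j = fcoeff h j"
  unfolding fcoeff_def using assms by (intro Bochner_Integration.integral_cong) auto

lemma L2norm_cong:
  assumes "\<And>x. x \<in> {0..<1} \<Longrightarrow> g x = h x"
  shows "L2norm g = L2norm h"
  unfolding L2norm_def using assms by (intro arg_cong[where f = sqrt] Bochner_Integration.integral_cong) auto

lemma in_L2_cong:
  assumes "\<And>x. x \<in> {0..<1} \<Longrightarrow> g x = h x"
  shows "in_L2 g \<longleftrightarrow> in_L2 h"
  unfolding in_L2_def using assms
  by (intro conj_cong measurable_cong Bochner_Integration.integrable_cong) auto

lemma in_L2_continuous:
  assumes "continuous_on UNIV h"
  shows "in_L2 (cpx h)"
  unfolding in_L2_def cpx_def
  by (intro conjI borel_measurable_integrable integrable_LI_continuous continuous_intros assms)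

text \<open>\<open>f0\<close> vanishes off [0,1), so the identity is confined to the circle; the
  congruence lemmas above transfer coefficients, norm and square integrability.\<close>

lemma trig_poly_diff_f0:
  "x \<in> {0..<1} \<Longrightarrow> cpx (\<lambda>x. trig_poly 1 J u v x - f0 x) x = cpx (trig_poly 0 J u v) x"
  by (simp add: cpx_def f0_def trig_poly_def)

text \<open>The harmonics have mean zero, hence mass 1; an absolute coefficient sum of at most 1
  keeps the perturbation above -1.\<close>

lemma trig_poly_in_densities:
  assumes J: "finite J" "\<And>j. j \<in> J \<Longrightarrow> j \<ge> 1" and u: "(\<Sum>j\<in>J. \<bar>u j\<bar>) \<le> 1"
  shows "trig_poly 1 J u (\<lambda>_. 0) \<in> densities"
proof -
  have "0 \<le> trig_poly 1 J u (\<lambda>_. 0) x" for x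
  proof -
    have "\<bar>\<Sum>j\<in>J. harmonic j (u j) 0 x\<bar> \<le> (\<Sum>j\<in>J. \<bar>u j\<bar>)"
      by (intro order.trans[OF sum_abs] sum_mono) (simp add: harmonic_def abs_mult mult_left_le)
    thus ?thesis using u by (simp add: trig_poly_def)
  qed
  thus ?thesis
    using J by (simp add: densities_def in_L2_continuous continuous_trig_poly LINT_LI_trig_poly)
qed

lemma L2norm_trig_poly_diff_f0:
  assumes "finite J" "\<And>j. j \<in> J \<Longrightarrow> j \<ge> 1"
  shows "L2norm (cpx (\<lambda>x. trig_poly 1 J u v x - f0 x)) = sqrt (\<Sum>j\<in>J. ((u j)\<^sup>2 + (v j)\<^sup>2) / 2)"
proof -
  have "L2norm (cpx (\<lambda>x. trig_poly 1 J u v x - f0 x)) = L2norm (cpx (trig_poly 0 J u v))"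
    by (intro L2norm_cong trig_poly_diff_f0)
  also have "\<dots> = sqrt (\<Sum>j\<in>J. ((u j)\<^sup>2 + (v j)\<^sup>2) / 2)"
    using LINT_LI_trig_poly_mult[OF assms(1,1) assms(2,2), of 0 u v 0 u v]
    by (simp add: L2norm_def cpx_def power2_eq_square)
  finally show ?thesis .
qed

lemma trig_poly_diff_f0_in_ellipsoid:
  assumes J: "finite J" "\<And>j. j \<in> J \<Longrightarrow> j \<ge> 1"
    and le: "(\<Sum>j\<in>J. ((u j)\<^sup>2 + (v j)\<^sup>2) / (a j)\<^sup>2) \<le> 2 * R\<^sup>2"
  shows "cpx (\<lambda>x. trig_poly 1 J u v x - f0 x) \<in> ellipsoid a R"
proof -
  let ?h = "cpx (\<lambda>x. trig_poly 1 J u v x - f0 x)"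
  let ?g = "\<lambda>j. if j = 0 then 0 else (cmod (fcoeff ?h (int j)))\<^sup>2 / (a j)\<^sup>2"
  have coeff: "fcoeff ?h (int l) = (if l \<in> J then Complex (u l / 2) (v l / 2) else 0)" if "l \<ge> 1" for l
    by (subst fcoeff_cong[OF trig_poly_diff_f0]) (simp_all add: fcoeff_trig_poly[OF J that])
  \<comment> \<open>The Fourier coefficient carries half of the real coefficients, hence the 1/4.
    With the factor 2 in \<open>ellipsoid\<close> this explains the threshold
    \<open>2 * R\<^sup>2\<close>.\<close>
  have g: "?g j = (if j \<in> J then ((u j)\<^sup>2 + (v j)\<^sup>2) / (a j)\<^sup>2 / 4 else 0)" for j
    using J(2)[of j] by (auto simp: coeff cmod_power2 power_divide add_divide_distrib)
  have "?g sums (\<Sum>j\<in>J. ((u j)\<^sup>2 + (v j)\<^sup>2) / (a j)\<^sup>2 / 4)"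
    unfolding g by (rule sums_If_finite_set[OF J(1)])
  moreover have "2 * (\<Sum>j\<in>J. ((u j)\<^sup>2 + (v j)\<^sup>2) / (a j)\<^sup>2 / 4) \<le> R\<^sup>2"
    using le unfolding sum_divide_distrib[of _ J 4, symmetric] by linarith
  moreover have "in_L2 ?h"
    by (subst in_L2_cong[OF trig_poly_diff_f0]) (simp_all add: in_L2_continuous continuous_trig_poly)
  ultimately show ?thesis
    unfolding ellipsoid_def by (auto simp: sums_iff)
qed

lemma cmod_fcoeff_le_1:
  assumes "\<phi> \<in> densities"
  shows "cmod (fcoeff (cpx \<phi>) j) \<le> 1"
proof -
  have "cmod (fcoeff (cpx \<phi>) j) \<le> (LINT x|LI. cmod (cpx \<phi> x * cis (2 * pi * of_int j * x)))"
    unfolding fcoeff_def by (rule integral_norm_bound)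
  also have "\<dots> = (LINT x|LI. \<phi> x)"
    using assms
    by (intro Bochner_Integration.integral_cong) (auto simp: norm_mult cpx_def densities_def)
  finally show ?thesis using assms by (simp add: densities_def)
qed

text \<open>The cross moment, under the uniform law, of the one-observation likelihood ratios of two
  alternatives.\<close>

lemma integral_conv_product:
  assumes phi: "\<phi> \<in> densities"
    and J: "finite J" "finite J'" "\<And>j. j \<in> J \<Longrightarrow> j \<ge> 1" "\<And>j. j \<in> J' \<Longrightarrow> j \<ge> 1"
  shows "(LINT y|LI. circ_conv (trig_poly 1 J u (\<lambda>_. 0)) \<phi> y * circ_conv (trig_poly 1 J' u' (\<lambda>_. 0)) \<phi> y) =
     1 + (\<Sum>j\<in>J \<inter> J'. u j * u' j * (cmod (fcoeff (cpx \<phi>) (int j)))\<^sup>2 / 2)"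
proof -
  have one: "(LINT x|LI. \<phi> x) = 1" using phi by (simp add: densities_def)
  show ?thesis
    unfolding circ_conv_trig_poly[OF densities_integrable[OF phi] one]
    using J by (simp add: LINT_LI_trig_poly_mult cmod_power2)
       (simp add: power2_eq_square algebra_simps)
qed

text \<open>Here \<open>chi\<close> bounds the second moment of the averaged likelihood ratio; the
  n-th power comes from the independence of the n observations. For each test some hypothesis i has
  large error, and its own sequence \<open>a i\<close> then witnesses the supremum over
  \<A>.\<close>

lemma minimax_lower_bound:
  fixes J :: "'i \<Rightarrow> nat set" and u :: "'i \<Rightarrow> nat \<Rightarrow> real" and n :: nat
  assumes phi: "\<phi> \<in> densities" and \<alpha>: "0 < \<alpha>" and \<Delta>: "\<Delta> \<in> tests n"
    and I: "finite I" "I \<noteq> {}"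
    and J: "\<And>i. i \<in> I \<Longrightarrow> finite (J i)" "\<And>i j. i \<in> I \<Longrightarrow> j \<in> J i \<Longrightarrow> j \<ge> 1"
    and u: "\<And>i. i \<in> I \<Longrightarrow> (\<Sum>j\<in>J i. \<bar>u i j\<bar>) \<le> 1"
    and a: "\<And>i. i \<in> I \<Longrightarrow> a i \<in> \<A>"
    and ell: "\<And>i. i \<in> I \<Longrightarrow> (\<Sum>j\<in>J i. (u i j)\<^sup>2 / (a i j)\<^sup>2) \<le> 2 * R\<^sup>2"
    and sep: "\<And>i. i \<in> I \<Longrightarrow> \<rho> (a i) \<le> sqrt (\<Sum>j\<in>J i. (u i j)\<^sup>2 / 2)"
    and chi: "(\<Sum>i\<in>I. \<Sum>k\<in>I.
        (1 + (\<Sum>j\<in>J i \<inter> J k. u i j * u k j * (cmod (fcoeff (cpx \<phi>) (int j)))\<^sup>2 / 2)) ^ n)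
      \<le> (1 + \<alpha>\<^sup>2) * (real (card I))\<^sup>2"
  shows "ennreal (1 - \<alpha>) \<le> (SUP a\<in>\<A>. risk n \<phi> \<Delta> (ellipsoid a R) (\<rho> a))"
proof -
  let ?U = "PiM {..<n} (\<lambda>_. LI)"
  interpret U: prob_space ?U by (rule prob_space_PiM) (rule prob_space_LI)
  have one: "(LINT x|LI. \<phi> x) = 1" and phi_nonneg: "\<And>x. x \<in> {0..<1} \<Longrightarrow> 0 \<le> \<phi> x"
    using phi by (simp_all add: densities_def)
  define f where "f = (\<lambda>i. trig_poly 1 (J i) (u i) (\<lambda>_. 0))"
  define T where "T = (\<lambda>i. circ_conv (f i) \<phi>)"
  have T_eq: "T i = trig_poly 1 (J i) (\<lambda>j. u i j * Re (fcoeff (cpx \<phi>) (int j)))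
       (\<lambda>j. u i j * Im (fcoeff (cpx \<phi>) (int j)))" for i
    by (simp add: T_def f_def circ_conv_trig_poly[OF densities_integrable[OF phi] one] fun_eq_iff)
  have T_cont: "continuous_on UNIV (T i)" for i
    unfolding T_eq by (rule continuous_trig_poly)
  have f_dens: "f i \<in> densities" if "i \<in> I" for i
    unfolding f_def using that J u by (intro trig_poly_in_densities) auto
  have T_nonneg: "0 \<le> T i x" if "i \<in> I" for i x
    unfolding T_def using f_dens[OF that] phi by (intro circ_conv_nonneg) (auto simp: densities_def)
  have T_1: "(LINT x|LI. T i x) = 1" if "i \<in> I" for i
    unfolding T_eq using J that by (intro LINT_LI_trig_poly) auto
  define G where "G = (\<lambda>i \<omega>. \<Prod>l<n. T i (\<omega> l))"
  define D where "D = {\<omega> \<in> space ?U. \<not> \<Delta> \<omega>}"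
  have [measurable]: "\<Delta> \<in> ?U \<rightarrow>\<^sub>M count_space UNIV" using \<Delta> by (simp add: tests_def)
  have D: "D \<in> sets ?U" unfolding D_def by measurable
  have GG: "G i \<omega> * G k \<omega> = (\<Prod>l<n. T i (\<omega> l) * T k (\<omega> l))" for i k \<omega>
    by (simp add: G_def prod.distrib)
  have TT_cont: "continuous_on UNIV (\<lambda>x. T i x * T k x)" for i k
    using T_cont by (intro continuous_intros)
  have "\<exists>i\<in>I. 1 - \<alpha> \<le> U.prob (space ?U - D) + (LINT \<omega>|?U. G i \<omega> * indicator D \<omega>)"
  proof (rule U.ex_hypothesis_large_error[OF I \<alpha> D])
    fix i assume i: "i \<in> I"
    show "integrable ?U (G i)" unfolding G_def by (rule integrable_prod_LI[OF T_cont])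
    show "(LINT \<omega>|?U. G i \<omega>) = 1" unfolding G_def by (simp add: LINT_prod_LI[OF T_cont] T_1 i)
    show "integrable ?U (\<lambda>\<omega>. G i \<omega> * G k \<omega>)" for k
      unfolding GG by (rule integrable_prod_LI[OF TT_cont])
  next
    have "(LINT \<omega>|?U. G i \<omega> * G k \<omega>) =
        (1 + (\<Sum>j\<in>J i \<inter> J k. u i j * u k j * (cmod (fcoeff (cpx \<phi>) (int j)))\<^sup>2 / 2)) ^ n"
      if "i \<in> I" "k \<in> I" for i k
      unfolding GG LINT_prod_LI[OF TT_cont] unfolding T_def f_def
      using J that by (subst integral_conv_product[OF phi]) auto
    thus "(\<Sum>i\<in>I. \<Sum>k\<in>I. LINT \<omega>|?U. G i \<omega> * G k \<omega>) \<le> (1 + \<alpha>\<^sup>2) * (real (card I))\<^sup>2"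
      using chi by simp
  qed
  then obtain i where i: "i \<in> I"
    and ge: "1 - \<alpha> \<le> U.prob (space ?U - D) + (LINT \<omega>|?U. G i \<omega> * indicator D \<omega>)" ..
  have sp: "space (sample_law n \<phi> g) = space ?U" for g
    by (simp add: sample_law_def obs_law_def space_PiM)
  have rej: "prob_reject n \<phi> f0 \<Delta> = ennreal (U.prob (space ?U - D))"
  proof -
    \<comment> \<open>Under the null hypothesis the observations are again uniform, so the
      likelihood ratio is 1.\<close>
    have "circ_conv f0 \<phi> y = 1" for y
    proof -
      have "f0 (y - s - of_int \<lfloor>y - s\<rfloor>) = 1" for s
        using frac_ge_0[of "y - s"] frac_lt_1[of "y - s"] by (simp add: frac_def f0_def)
      thus ?thesis using one by (simp add: circ_conv_def)
    qed
    moreover have "{\<omega> \<in> space (sample_law n \<phi> f0). \<Delta> \<omega>} = space ?U - D"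
      by (auto simp: D_def sp)
    ultimately have "prob_reject n \<phi> f0 \<Delta> =
        ennreal (LINT \<omega>|?U. (\<Prod>l<n. 1) * indicator (space ?U - D) \<omega>)"
      unfolding prob_reject_def using D LI.prob_space
      by (simp only:) (intro emeasure_sample_law; auto)
    thus ?thesis using D by (simp add: U.emeasure_eq_measure)
  qed
  have "prob_accept n \<phi> (f i) \<Delta> = ennreal (LINT \<omega>|?U. G i \<omega> * indicator D \<omega>)"
    unfolding prob_accept_def sp D_def[symmetric] G_def
    using T_cont T_nonneg[OF i] T_1[OF i] D by (intro emeasure_sample_law) (auto simp: T_def)
  moreover have "f i \<in> {f \<in> densities. cpx (\<lambda>x. f x - f0 x) \<in> ellipsoid (a i) R \<and>
      L2norm (cpx (\<lambda>x. f x - f0 x)) \<ge> \<rho> (a i)}"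
  proof -
    have "cpx (\<lambda>x. f i x - f0 x) \<in> ellipsoid (a i) R"
      unfolding f_def using J[OF i] ell[OF i] by (intro trig_poly_diff_f0_in_ellipsoid) auto
    moreover have "L2norm (cpx (\<lambda>x. f i x - f0 x)) = sqrt (\<Sum>j\<in>J i. (u i j)\<^sup>2 / 2)"
      unfolding f_def using J[OF i] by (subst L2norm_trig_poly_diff_f0) auto
    ultimately show ?thesis using f_dens[OF i] sep[OF i] by simp
  qed
  ultimately have acc: "ennreal (LINT \<omega>|?U. G i \<omega> * indicator D \<omega>) \<le>
     (SUP f \<in> {f \<in> densities. cpx (\<lambda>x. f x - f0 x) \<in> ellipsoid (a i) R \<and>
         L2norm (cpx (\<lambda>x. f x - f0 x)) \<ge> \<rho> (a i)}. prob_accept n \<phi> f \<Delta>)"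
    by (intro SUP_upper2[of "f i"]) auto
  have "0 \<le> (LINT \<omega>|?U. G i \<omega> * indicator D \<omega>)"
    using T_nonneg[OF i] by (auto simp: G_def intro!: Bochner_Integration.integral_nonneg mult_nonneg_nonneg prod_nonneg)
  hence "ennreal (U.prob (space ?U - D) + (LINT \<omega>|?U. G i \<omega> * indicator D \<omega>)) =
      ennreal (U.prob (space ?U - D)) + ennreal (LINT \<omega>|?U. G i \<omega> * indicator D \<omega>)"
    by (intro ennreal_plus) auto
  hence "ennreal (1 - \<alpha>) \<le> ennreal (U.prob (space ?U - D)) + ennreal (LINT \<omega>|?U. G i \<omega> * indicator D \<omega>)"
    using ennreal_leI[OF ge] by simp
  also have "\<dots> \<le> risk n \<phi> \<Delta> (ellipsoid (a i) R) (\<rho> (a i))"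
    unfolding risk_def rej using acc by (intro add_left_mono)
  also have "\<dots> \<le> (SUP a\<in>\<A>. risk n \<phi> \<Delta> (ellipsoid a R) (\<rho> a))"
    using a[OF i] by (rule SUP_upper)
  finally show ?thesis .
qed

subsection \<open>Dyadic blocks\<close>

lemma nu_square_le:
  assumes c: "0 < c" and p: "0 \<le> p" and phi: "integrable LI \<phi>" and k: "k \<ge> 1"
    and lb: "\<And>j::nat. j \<ge> 1 \<Longrightarrow> c * real j powr (- p) \<le> cmod (fcoeff (cpx \<phi>) (int j))"
  shows "(nu \<phi> k)\<^sup>2 \<le> 2 / c\<^sup>2 * real k powr (2 * p + 1/2)"
proof -
  define S where "S = {j::int. 1 \<le> \<bar>j\<bar> \<and> \<bar>j\<bar> \<le> int k}"
  define F where "F = (\<lambda>j. 1 / (cmod (fcoeff (cpx \<phi>) j)) ^ 4)"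
  have S: "S = {- int k..-1} \<union> {1..int k}" by (auto simp: S_def)
  have "card S = 2 * k" unfolding S by (subst card_Un_disjoint) auto
  \<comment> \<open>The lower decay bound is decreasing in the frequency, so each of the 2k terms is
    dominated by the one at frequency k; negative frequencies have the same modulus.\<close>
  have F_le: "F j \<le> 1 / c ^ 4 * real k powr (4 * p)" if "j \<in> S" for j
  proof -
    define i where "i = nat \<bar>j\<bar>"
    have i: "1 \<le> i" "i \<le> k" using that by (auto simp: i_def S_def)
    have pos: "0 < c * real k powr (- p)" using c k by simp
    have "c * real k powr (- p) \<le> c * real i powr (- p)"
      using c i p by (intro mult_left_mono powr_mono2') auto
    also have "\<dots> \<le> cmod (fcoeff (cpx \<phi>) (int i))" by (rule lb[OF i(1)])
    also have "\<dots> = cmod (fcoeff (cpx \<phi>) j)"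
      using fcoeff_uminus[OF phi, of j] by (cases "j \<ge> 0") (auto simp: i_def)
    finally have "(c * real k powr (- p)) ^ 4 \<le> (cmod (fcoeff (cpx \<phi>) j)) ^ 4"
      using pos by (intro power_mono) auto
    moreover have "0 < (c * real k powr (- p)) ^ 4" using pos by (rule zero_less_power)
    ultimately have "F j \<le> 1 / (c * real k powr (- p)) ^ 4"
      unfolding F_def by (intro divide_left_mono mult_pos_pos) auto
    also have "\<dots> = 1 / c ^ 4 * real k powr (4 * p)"
      using k by (simp add: power_mult_distrib powr_power powr_minus field_simps)
    finally show ?thesis .
  qed
  have F_nonneg: "0 \<le> F j" for j by (simp add: F_def)
  have "sum F S \<le> real (card S) * (1 / c ^ 4 * real k powr (4 * p))"
    using F_le by (rule sum_bounded_above)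
  also have "\<dots> = (sqrt 2 / c\<^sup>2 * real k powr (2 * p + 1/2))\<^sup>2"
    using k \<open>card S = 2 * k\<close>
    by (simp add: power_mult_distrib power_divide powr_power algebra_simps powr_add)
  finally have "sqrt (sum F S) \<le> sqrt 2 / c\<^sup>2 * real k powr (2 * p + 1/2)"
    by (rule real_le_lsqrt[rotated]) (use F_nonneg in \<open>auto intro: sum_nonneg\<close>)
  also have "\<dots> \<le> 2 / c\<^sup>2 * real k powr (2 * p + 1/2)"
    using sqrt2_less_2 by (intro mult_right_mono divide_right_mono) auto
  also have "sqrt (sum F S) = (nu \<phi> k)\<^sup>2"
  proof -
    have "nu \<phi> k = sum F S powr (1/4)" by (simp add: nu_def S_def F_def)
    thus ?thesis using F_nonneg 
      by (simp add: power2_eq_square powr_add[symmetric] powr_half_sqrt[symmetric] sum_nonneg)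
  qed
  finally show ?thesis .
qed

lemma rho_le:
  assumes "k \<ge> 1" "0 < x"
  shows "rho \<phi> a x \<le> sqrt (max ((a k)\<^sup>2) ((nu \<phi> k)\<^sup>2 / x))"
proof -
  have "bdd_below ((\<lambda>k. max ((a k)\<^sup>2) ((nu \<phi> k)\<^sup>2 / x)) ` {1..})"
    by (intro bdd_belowI[of _ 0]) (auto simp: le_max_iff_disj)
  thus ?thesis
    unfolding rho_def using assms by (intro real_sqrt_le_mono cInf_lower) auto
qed

lemma rho_nonneg: "0 \<le> rho \<phi> a x"
  unfolding rho_def by (intro real_sqrt_ge_zero cInf_greatest) (auto simp: le_max_iff_disj)

text \<open>Excluding the left and including the right endpoint gives exactly \<open>2 ^ m\<close>
  frequencies and makes consecutive blocks disjoint.\<close>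

definition block :: "nat \<Rightarrow> nat set" where
  "block m = {2 ^ m<..2 ^ Suc m}"

text \<open>Scaled so that \<open>2 ^ m\<close> squared coefficients, weighted by j^(2s) with j of
  order 2^m, sum to order b. The free constant b is fixed in the final proof.\<close>

definition amplitude :: "real \<Rightarrow> real \<Rightarrow> nat \<Rightarrow> real" where
  "amplitude b s m = sqrt b * 2 powr - (real m * (s + 1/2))"

lemma finite_block [simp]: "finite (block m)"
  and card_block [simp]: "card (block m) = 2 ^ m"
  by (simp_all add: block_def)

lemma block_ge_1: "j \<in> block m \<Longrightarrow> 1 \<le> j"
  by (auto simp: block_def)

lemma real_block:
  assumes "j \<in> block m"
  shows "2 powr real m \<le> real j" "real j \<le> 2 powr (real m + 1)"
proof -
  have "2 ^ m \<le> j" "j \<le> 2 ^ (m + 1)" using assms by (auto simp: block_def)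
  hence "real (2 ^ m) \<le> real j" "real j \<le> real (2 ^ (m + 1))" by (simp_all only: of_nat_le_iff)
  thus "2 powr real m \<le> real j" "real j \<le> 2 powr (real m + 1)"
    by (simp_all add: powr_realpow powr_add)
qed

lemma disjoint_block:
  assumes "m \<noteq> m'"
  shows "block m \<inter> block m' = {}"
proof -
  have "block m \<inter> block m' = {}" if "m < m'" for m m'
  proof -
    have "(2::nat) ^ Suc m \<le> 2 ^ m'" using that by (intro power_increasing) auto
    thus ?thesis by (auto simp: block_def)
  qed
  thus ?thesis using assms by (metis Int_commute nat_neq_iff)
qed

lemma amplitude_nonneg: "0 \<le> amplitude b s m" if "0 \<le> b"
  using that by (simp add: amplitude_def)

lemma amplitude_square:
  assumes "0 \<le> b"
  shows "(amplitude b s m)\<^sup>2 = b * 2 powr - (real m * (2 * s + 1))"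
proof -
  have "(2 powr - (real m * (s + 1/2)))\<^sup>2 = 2 powr - (real m * (2 * s + 1))"
    unfolding power2_eq_square powr_add[symmetric]
    by (intro arg_cong[where f = "(powr) 2"]) (simp add: algebra_simps)
  thus ?thesis using assms by (simp add: amplitude_def power_mult_distrib)
qed

text \<open>The absolute coefficient sum is 2 sqrt b times 2 to the power m (1/2 - s), so smoothness
  at least 1/2 and b \<le> 1/4 keep the alternatives nonnegative.\<close>

lemma amplitude_sum_le:
  assumes "0 \<le> b" "b \<le> 1/4" "1/2 \<le> s"
  shows "2 ^ m * (2 * amplitude b s m) \<le> 1"
proof -
  have "2 ^ m * (2 * amplitude b s m) = 2 * sqrt b * 2 powr (real m * (1/2 - s))"
    by (simp add: amplitude_def powr_realpow[symmetric] algebra_simps powr_add[symmetric])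
  also have "\<dots> \<le> 2 * sqrt (1/4) * 2 powr 0"
    using assms by (intro mult_mono real_sqrt_le_mono powr_mono) (auto intro: mult_nonneg_nonpos)
  also have "\<dots> = 1" by (simp add: real_sqrt_divide)
  finally show ?thesis .
qed

text \<open>Within a block j is at most twice 2^m, which costs 4^s; passing to 4^t makes the bound
  uniform over the smoothness levels.\<close>

lemma block_ellipsoid_le:
  assumes b: "0 \<le> b" and s: "0 \<le> s" "s \<le> t" and e: "\<And>j. j \<in> block m \<Longrightarrow> (e j)\<^sup>2 = 1"
    and a: "\<And>j. j \<ge> 1 \<Longrightarrow> a j = real j powr (- s)"
  shows "(\<Sum>j\<in>block m. (2 * amplitude b s m * e j)\<^sup>2 / (a j)\<^sup>2) \<le> 4 * b * 4 powr t"
proof -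
  let ?r = "amplitude b s m"
  have "(2 * ?r * e j)\<^sup>2 / (a j)\<^sup>2 \<le> 4 * ?r\<^sup>2 * 2 powr ((real m + 1) * (2 * s))" if j: "j \<in> block m" for j
  proof -
    have "(2 * ?r * e j)\<^sup>2 / (a j)\<^sup>2 = 4 * ?r\<^sup>2 * real j powr (2 * s)"
    proof -
      have "(a j)\<^sup>2 = inverse (real j powr (2 * s))"
        unfolding a[OF block_ge_1[OF j]] power2_eq_square powr_add[symmetric] powr_minus[symmetric] by simp
      thus ?thesis using e[OF j] by (simp add: power_mult_distrib divide_inverse)
    qed
    also have "real j powr (2 * s) \<le> (2 powr (real m + 1)) powr (2 * s)"
      using real_block[OF j] s by (intro powr_mono2) auto
    finally show ?thesis by (simp add: powr_powr mult_left_mono)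
  qed
  hence "(\<Sum>j\<in>block m. (2 * ?r * e j)\<^sup>2 / (a j)\<^sup>2) \<le>
      real (card (block m)) * (4 * ?r\<^sup>2 * 2 powr ((real m + 1) * (2 * s)))"
    by (rule sum_bounded_above)
  also have "\<dots> = 4 * b * (2 powr m * 2 powr - (real m * (2 * s + 1)) * 2 powr ((real m + 1) * (2 * s)))"
    using b by (simp add: amplitude_square powr_realpow)
  also have "2 powr m * 2 powr - (real m * (2 * s + 1)) * 2 powr ((real m + 1) * (2 * s)) = 2 powr (2 * s)"
    by (simp add: powr_add[symmetric] algebra_simps)
  also have "\<dots> = 4 powr s" using powr_powr[of 2 2 s] by simp
  also have "4 * b * 4 powr s \<le> 4 * b * 4 powr t"
    using b s by (intro mult_left_mono powr_mono) auto
  finally show ?thesis .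
qed

lemma block_L2:
  assumes b: "0 \<le> b" and e: "\<And>j. j \<in> block m \<Longrightarrow> (e j)\<^sup>2 = 1"
  shows "(\<Sum>j\<in>block m. (2 * amplitude b s m * e j)\<^sup>2 / 2) = 2 * b * 2 powr - (2 * real m * s)"
proof -
  have "(\<Sum>j\<in>block m. (2 * amplitude b s m * e j)\<^sup>2 / 2) = (\<Sum>j\<in>block m. 2 * (amplitude b s m)\<^sup>2)"
    using e by (intro sum.cong) (simp_all add: power_mult_distrib)
  also have "\<dots> = 2 * b * (2 powr m * 2 powr - (real m * (2 * s + 1)))"
    using b by (simp add: amplitude_square powr_realpow)
  also have "2 powr m * 2 powr - (real m * (2 * s + 1)) = 2 powr - (2 * real m * s)"
    by (simp add: powr_add[symmetric] algebra_simps)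
  finally show ?thesis .
qed

text \<open>Evaluates the minimum at k = 2^m. The assumption on y is the balance condition: both
  a_k^2 and \<nu>_k^2/y are then of order 2^(-2ms).\<close>

lemma rho_block_le:
  assumes c: "0 < c" and p: "0 \<le> p" and phi: "integrable LI \<phi>"
    and lb: "\<And>j::nat. j \<ge> 1 \<Longrightarrow> c * real j powr (- p) \<le> cmod (fcoeff (cpx \<phi>) (int j))"
    and a: "\<And>j. j \<ge> 1 \<Longrightarrow> a j = real j powr (- s)"
    and y: "y = 2 powr (real m * (2 * s + 2 * p + 1/2))"
  shows "rho \<phi> a y \<le> sqrt (max 1 (2 / c\<^sup>2) * 2 powr - (2 * real m * s))"
proof -
  let ?k = "2 ^ m :: nat" and ?z = "2 powr - (2 * real m * s)"
  have k: "real ?k powr t = 2 powr (real m * t)" for t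
    by (simp add: powr_realpow[symmetric] powr_powr)
  have a_eq: "(a ?k)\<^sup>2 = ?z"
  proof -
    have "(a ?k)\<^sup>2 = (2 powr (real m * (- s)))\<^sup>2" by (simp only: a[of ?k] k one_le_power one_le_numeral)
    also have "\<dots> = ?z"
      unfolding power2_eq_square powr_add[symmetric]
      by (intro arg_cong[where f = "(powr) 2"]) (simp add: algebra_simps)
    finally show ?thesis .
  qed
  have "(nu \<phi> ?k)\<^sup>2 / y \<le> 2 / c\<^sup>2 * real ?k powr (2 * p + 1/2) / y"
    using y by (intro divide_right_mono nu_square_le[OF c p phi _ lb]) auto
  also have "\<dots> = 2 / c\<^sup>2 * (2 powr (real m * (2 * p + 1/2)) / 2 powr (real m * (2 * s + 2 * p + 1/2)))"
    by (simp only: k y times_divide_eq_right)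
  also have "2 powr (real m * (2 * p + 1/2)) / 2 powr (real m * (2 * s + 2 * p + 1/2)) = ?z"
    unfolding powr_diff[symmetric] by (intro arg_cong[where f = "(powr) 2"]) (simp add: algebra_simps)
  finally have "max ((a ?k)\<^sup>2) ((nu \<phi> ?k)\<^sup>2 / y) \<le> max 1 (2 / c\<^sup>2) * ?z"
    unfolding a_eq by (auto simp: max_mult_distrib_right le_max_iff_disj)
  moreover have "rho \<phi> a y \<le> sqrt (max ((a ?k)\<^sup>2) ((nu \<phi> ?k)\<^sup>2 / y))"
    using y by (intro rho_le) auto
  ultimately show ?thesis by (meson order.trans real_sqrt_le_mono)
qed

text \<open>The powers of 2 from block size, amplitude and decay combine to 1 / (d n)^2, so the
  sample size cancels and only d remains.\<close>

lemma block_chi_le: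
  assumes b: "0 \<le> b" "b \<le> 1 / (3 * C\<^sup>2)" and C: "0 < C" and p: "0 \<le> p"
    and F: "\<And>j. j \<in> block m \<Longrightarrow> 0 \<le> F j \<and> F j \<le> C * real j powr (- p)"
    and y: "d * real n = 2 powr (real m * (2 * s + 2 * p + 1/2))" and d: "0 < d"
  shows "(\<Sum>j\<in>block m. (real n * (2 * (amplitude b s m)\<^sup>2 * (F j)\<^sup>2))\<^sup>2) \<le> 1 / (2 * d\<^sup>2)"
proof -
  let ?r = "amplitude b s m"
  have "(real n * (2 * ?r\<^sup>2 * (F j)\<^sup>2))\<^sup>2 \<le> (real n * (2 * ?r\<^sup>2 * (C\<^sup>2 * 2 powr - (2 * m * p))))\<^sup>2"
    if j: "j \<in> block m" for j
  proof -
    have "F j \<le> C * real j powr (- p)" using F[OF j] by simp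
    also have "\<dots> \<le> C * (2 powr m) powr (- p)"
      using real_block[OF j] C p by (intro mult_left_mono powr_mono2') auto
    finally have "(F j)\<^sup>2 \<le> (C * (2 powr m) powr (- p))\<^sup>2"
      using F[OF j] by (intro power_mono) auto
    also have "\<dots> = C\<^sup>2 * 2 powr - (2 * m * p)"
      by (simp add: power_mult_distrib powr_powr powr_power mult_ac)
    finally show ?thesis by (intro power_mono mult_left_mono) auto
  qed
  hence "(\<Sum>j\<in>block m. (real n * (2 * ?r\<^sup>2 * (F j)\<^sup>2))\<^sup>2) \<le>
      real (card (block m)) * (real n * (2 * ?r\<^sup>2 * (C\<^sup>2 * 2 powr - (2 * m * p))))\<^sup>2"
    by (rule sum_bounded_above)
  also have "\<dots> = 4 * (b * C\<^sup>2)\<^sup>2 * (real n)\<^sup>2 *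
      (2 powr m * (2 powr - (real m * (2 * s + 1)))\<^sup>2 * (2 powr - (2 * m * p))\<^sup>2)"
    using b by (simp add: amplitude_square powr_realpow power_mult_distrib mult_ac)
  also have "2 powr m * (2 powr - (real m * (2 * s + 1)))\<^sup>2 * (2 powr - (2 * m * p))\<^sup>2 =
      1 / (d * real n)\<^sup>2"
    unfolding y by (simp add: powr_power powr_add[symmetric] powr_minus_divide[symmetric] algebra_simps)
  also have "4 * (b * C\<^sup>2)\<^sup>2 * (real n)\<^sup>2 * (1 / (d * real n)\<^sup>2) = 4 * (b * C\<^sup>2)\<^sup>2 / d\<^sup>2"
  proof -
    have "n \<noteq> 0" using y by (auto intro: ccontr)
    thus ?thesis by (simp add: power_mult_distrib)
  qed
  \<comment> \<open>The cap on b gives b C^2 \<le> 1/3, and 4/9 \<le> 1/2.\<close>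
  also have "\<dots> \<le> 4 * (1/3)\<^sup>2 / d\<^sup>2"
    using b C by (intro divide_right_mono mult_left_mono power_mono) (auto simp: field_simps)
  also have "\<dots> \<le> 1 / (2 * d\<^sup>2)" using d by (simp add: field_simps)
  finally show ?thesis .
qed

text \<open>The right side, a multiple of a lower bound on the number of blocks, grows like log n
  since \<open>delta\<close> costs only a power of log log n; the left side is the chi-square cost
  of one block. The first conjunct resolves the maximum in \<open>delta\<close>.\<close>

lemma eventually_many_blocks:
  assumes "0 < \<beta>" "0 < \<kappa>"
  shows "\<forall>\<^sub>F n in sequentially. 1 \<le> ln (ln (real n)) \<and> 0 < log 2 (delta n * real n) \<and>
           sqrt (ln (real n)) \<le> \<beta> * (\<kappa> * log 2 (delta n * real n) - 1)"
proof -
  have 1: "\<forall>\<^sub>F n::nat in sequentially. 1 \<le> ln (ln (real n))" by real_asymp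
  have 2: "\<forall>\<^sub>F n::nat in sequentially. 0 < ln (ln (ln (real n)) powr (-1/2) * real n) / ln 2" by real_asymp
  have 3: "\<forall>\<^sub>F n::nat in sequentially. sqrt (ln (real n)) \<le>
      \<beta> * (\<kappa> * (ln (ln (ln (real n)) powr (-1/2) * real n) / ln 2) - 1)"
    using assms by real_asymp
  show ?thesis
    using 1 2 3 by eventually_elim (simp add: delta_def log_def)
qed

section \<open>Assembly of the lower bound\<close>

theorem theorem6p2:
  fixes \<phi> :: "real \<Rightarrow> real" and R s_lo s_hi p :: real and \<A> :: "(nat \<Rightarrow> real) set"
  assumes phi_dens: "\<phi> \<in> densities"
    and phi_nonzero: "\<forall>j. fcoeff (cpx \<phi>) j \<noteq> 0"
    and p_gt: "p > 1/2"
    and phi_decay: "\<exists>c C. 0 < c \<and> c \<le> C \<and> (\<forall>j::nat. j \<ge> 1 \<longrightarrow>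
            c * real j powr (-p) \<le> cmod (fcoeff (cpx \<phi>) (int j)) \<and>
            cmod (fcoeff (cpx \<phi>) (int j)) \<le> C * real j powr (-p))"
    and R_pos: "R > 0"
    and s_bounds: "1/2 < s_lo" "s_lo < s_hi"
    and A_seqs: "\<forall>a\<in>\<A>. \<forall>j::nat. j \<ge> 1 \<longrightarrow> 0 < a j \<and> a j \<le> 1 \<and> a (Suc j) \<le> a j"
    and A_contains: "\<forall>s\<in>{s_lo..s_hi}. \<exists>a\<in>\<A>. \<forall>j::nat. j \<ge> 1 \<longrightarrow> a j = real j powr (-s)"
  shows "\<forall>\<alpha>. 0 < \<alpha> \<and> \<alpha> < 1 \<longrightarrow>
           (\<exists>n0::nat. \<exists>Abar::real. 0 < Abar \<and>
              (\<forall>n\<ge>n0. \<forall>A\<in>{0..Abar}.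
                 (INF \<Delta>\<in>tests n. SUP a\<in>\<A>.
                    risk n \<phi> \<Delta> (ellipsoid a R) (A * rho \<phi> a (delta n * real n)))
                 \<ge> ennreal (1 - \<alpha>)))"
proof (intro allI impI)
  fix \<alpha> :: real assume \<alpha>: "0 < \<alpha> \<and> \<alpha> < 1"
  obtain c C where c: "0 < c" "c \<le> C"
    and lb: "\<And>j::nat. j \<ge> 1 \<Longrightarrow> c * real j powr (-p) \<le> cmod (fcoeff (cpx \<phi>) (int j))"
    and ub: "\<And>j::nat. j \<ge> 1 \<Longrightarrow> cmod (fcoeff (cpx \<phi>) (int j)) \<le> C * real j powr (-p)"
    using phi_decay by blast
  have C: "0 < C" and p: "0 \<le> p" using c p_gt by simp_all
  obtain aa where aa: "\<And>s. s \<in> {s_lo..s_hi} \<Longrightarrow> aa s \<in> \<A>"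
      "\<And>s j. s \<in> {s_lo..s_hi} \<Longrightarrow> j \<ge> 1 \<Longrightarrow> aa s j = real j powr (-s)"
    using A_contains by metis
  define q where "q = 2 * p + 1/2"
  \<comment> \<open>The three caps serve, in order, nonnegativity of the alternatives, membership in
    the ellipsoid, and the chi-square bound.\<close>
  define b where "b = min (1/4) (min (R\<^sup>2 / (2 * 4 powr s_hi)) (1 / (3 * C\<^sup>2)))"
  have b: "0 < b" "b \<le> 1/4" "b \<le> R\<^sup>2 / (2 * 4 powr s_hi)" "b \<le> 1 / (3 * C\<^sup>2)"
    using R_pos C by (simp_all add: b_def)
  define D where "D = max 1 (2 / c\<^sup>2)"
  have D: "1 \<le> D" by (simp add: D_def)
  \<comment> \<open>D is the constant lost in bounding the rate; with this choice
    \<open>Abar\<close> times the bound for \<open>rho\<close> equals the L2 norm of the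
    perturbation.\<close>
  define Abar where "Abar = sqrt (2 * b / D)"
  have Abar: "0 < Abar" using b D by (simp add: Abar_def)
  \<comment> \<open>With y = 2^L, the admissible levels m fill an interval of length
    \<open>\<kappa> * L\<close>.\<close>
  define \<kappa> where "\<kappa> = 1 / (2 * s_lo + q) - 1 / (2 * s_hi + q)"
  have q: "0 < q" using p by (simp add: q_def)
  have \<kappa>: "0 < \<kappa>"
    using s_bounds q unfolding \<kappa>_def by (simp add: frac_less2)
  obtain n0 where n0: "\<And>n. n \<ge> n0 \<Longrightarrow> 1 \<le> ln (ln (real n)) \<and> 0 < log 2 (delta n * real n) \<and>
           sqrt (ln (real n)) \<le> \<alpha>\<^sup>2 * (\<kappa> * log 2 (delta n * real n) - 1)"
    using eventually_many_blocks[of "\<alpha>\<^sup>2" \<kappa>] \<alpha> \<kappa> by (auto simp: eventually_sequentially)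
  have "(INF \<Delta>\<in>tests n. SUP a\<in>\<A>. risk n \<phi> \<Delta> (ellipsoid a R) (A * rho \<phi> a (delta n * real n)))
      \<ge> ennreal (1 - \<alpha>)" if n: "n \<ge> n0" and A: "A \<in> {0..Abar}" for n A
  proof (rule INF_greatest)
    fix \<Delta> assume \<Delta>: "\<Delta> \<in> tests n"
    define y where "y = delta n * real n"
    define L where "L = log 2 y"
    have lnln: "1 \<le> ln (ln (real n))" and L: "0 < L"
      and big: "sqrt (ln (real n)) \<le> \<alpha>\<^sup>2 * (\<kappa> * L - 1)"
      using n0[OF n] by (simp_all add: L_def y_def)
    \<comment> \<open>The second identity turns the chi-square exponent into half of log log n,
      whose exponential is sqrt (log n).\<close>
    have delta: "0 < delta n" "1 / (2 * (delta n)\<^sup>2) = ln (ln (real n)) / 2"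
    proof -
      have d: "delta n = ln (ln (real n)) powr (-1/2)" using lnln by (simp add: delta_def)
      show "0 < delta n" using lnln d by simp
      have "(delta n)\<^sup>2 = inverse (ln (ln (real n)))"
        using lnln unfolding d power2_eq_square powr_add[symmetric] by (simp add: powr_minus)
      thus "1 / (2 * (delta n)\<^sup>2) = ln (ln (real n)) / 2" by (simp add: inverse_eq_divide)
    qed
    \<comment> \<open>The convention ln 0 = 0 would give L = 0; the same convention excludes ln n =
      0 below.\<close>
    have "n \<noteq> 0"
    proof
      assume "n = 0"
      thus False using L by (simp add: L_def y_def log_def)
    qed
    hence y: "0 < y" using delta by (simp add: y_def)
    have ln_pos: "0 < ln (real n)"
    proof (rule ccontr)
      assume "\<not> ?thesis"
      moreover have "0 \<le> ln (real n)" using \<open>n \<noteq> 0\<close> by simp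
      ultimately have "ln (real n) = 0" by simp
      thus False using lnln by simp
    qed
    \<comment> \<open>The smoothness assigned to m decreases in m, so the largest smoothness yields
      the lower endpoint.\<close>
    define lo where "lo = L / (2 * s_hi + q)"
    define hi where "hi = L / (2 * s_lo + q)"
    have lo: "0 < lo" and hi: "0 < hi" using L q s_bounds by (simp_all add: lo_def hi_def)
    define M where "M = {nat \<lceil>lo\<rceil>..nat \<lfloor>hi\<rfloor>}"
    \<comment> \<open>the smoothness level whose optimal dimension is exactly \<open>2\<^sup>m\<close>\<close>
    define s where "s = (\<lambda>m::nat. (L / real m - q) / 2)"
    have M: "1 \<le> m" "s m \<in> {s_lo..s_hi}" "y = 2 powr (real m * (2 * s m + 2 * p + 1/2))" if "m \<in> M" for m
    proof -
      have m: "lo \<le> real m" "real m \<le> hi" "0 < real m"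
        using that lo order.trans[OF of_nat_mono of_nat_floor[of hi]] hi
        by (auto simp: M_def nat_le_iff ceiling_le_iff)
      show "1 \<le> m" using m by simp
      have "L / real m \<le> 2 * s_hi + q" "2 * s_lo + q \<le> L / real m"
        using m q s_bounds by (simp_all add: lo_def hi_def field_simps)
      thus "s m \<in> {s_lo..s_hi}" by (simp add: s_def)
      have "2 * s m + 2 * p + 1/2 = L / real m" by (simp add: s_def q_def field_simps)
      hence "real m * (2 * s m + 2 * p + 1/2) = L" using m by simp
      thus "y = 2 powr (real m * (2 * s m + 2 * p + 1/2))" using y by (simp add: L_def)
    qed
    have s_half: "1/2 \<le> s m" "0 \<le> s m" "s m \<le> s_hi" if "m \<in> M" for m
      using M(2)[OF that] s_bounds by auto
    define N where "N = real (card M)"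
    have "hi - lo - 1 \<le> N"
    proof -
      have "real (nat \<lfloor>hi\<rfloor>) = of_int \<lfloor>hi\<rfloor>" "real (nat \<lceil>lo\<rceil>) = of_int \<lceil>lo\<rceil>"
        using hi lo by simp_all
      moreover have "real (nat \<lfloor>hi\<rfloor>) + 1 - real (nat \<lceil>lo\<rceil>) \<le> N"
      proof -
        \<comment> \<open>Truncated subtraction is harmless: when it truncates, the left side is
          negative.\<close>
        have "real k + 1 - real l \<le> real (Suc k - l)" for k l :: nat
          by (cases "l \<le> Suc k") (simp_all add: of_nat_diff not_le)
        thus ?thesis unfolding N_def M_def card_atLeastAtMost .
      qed
      ultimately show ?thesis by linarith
    qed
    moreover have "hi - lo = \<kappa> * L"
      by (simp add: hi_def lo_def \<kappa>_def left_diff_distrib)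
    ultimately have "\<alpha>\<^sup>2 * (\<kappa> * L - 1) \<le> \<alpha>\<^sup>2 * N" by (intro mult_left_mono) auto
    hence N: "sqrt (ln (real n)) \<le> \<alpha>\<^sup>2 * N" using big by simp
    have "0 < \<alpha>\<^sup>2 * N" using N ln_pos by (meson less_le_trans real_sqrt_gt_zero)
    hence M_ne: "M \<noteq> {}" by (auto simp: N_def)
    define J where "J = (\<Union>m\<in>M. block m)"
    have fin: "finite M" "finite J" by (simp_all add: M_def J_def)
    \<comment> \<open>One sign vector covers all blocks at once, so the hypotheses form a product of
      levels and signs.\<close>
    define E where "E = PiE J (\<lambda>_. {-1, 1::real})"
    have E_sq: "(\<epsilon> j)\<^sup>2 = 1" if "\<epsilon> \<in> E" "m \<in> M" "j \<in> block m" for \<epsilon> m j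
    proof -
      have "\<epsilon> j \<in> {-1, 1}" using that by (auto simp: E_def J_def PiE_iff)
      thus ?thesis by auto
    qed
    have cardE: "card E = 2 ^ card J" unfolding E_def using fin(2) by (rule card_signs)
    let ?r = "\<lambda>m. amplitude b (s m) m"
    \<comment> \<open>A cosine with coefficient 2r has Fourier coefficient r; hence the factor
      2.\<close>
    let ?u = "\<lambda>(m, \<epsilon>) j. 2 * ?r m * \<epsilon> j"
    let ?F = "\<lambda>j. cmod (fcoeff (cpx \<phi>) (int j))"
    show "ennreal (1 - \<alpha>) \<le> (SUP a\<in>\<A>. risk n \<phi> \<Delta> (ellipsoid a R) (A * rho \<phi> a (delta n * real n)))"
      unfolding y_def[symmetric]
    proof (rule minimax_lower_bound[where I = "M \<times> E" and J = "\<lambda>(m, \<epsilon>). block m" and u = ?u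
          and a = "\<lambda>(m, \<epsilon>). aa (s m)"])
      show "\<phi> \<in> densities" "0 < \<alpha>" "\<Delta> \<in> tests n" by (use phi_dens \<alpha> \<Delta> in auto)
      show "finite (M \<times> E)" using fin by (simp add: E_def finite_PiE)
      show "M \<times> E \<noteq> {}" using M_ne by (auto simp: E_def PiE_eq_empty_iff)
    next
      fix i assume "i \<in> M \<times> E"
      then obtain m \<epsilon> where i: "i = (m, \<epsilon>)" and m: "m \<in> M" and \<epsilon>: "\<epsilon> \<in> E" by auto
      note sq = E_sq[OF \<epsilon> m]
      show "finite (case i of (m, \<epsilon>) \<Rightarrow> block m)" by (simp add: i)
      show "1 \<le> j" if "j \<in> (case i of (m, \<epsilon>) \<Rightarrow> block m)" for j
        using that by (simp add: i block_ge_1 del: One_nat_def)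
      have "(\<Sum>j\<in>block m. \<bar>2 * ?r m * \<epsilon> j\<bar>) = (\<Sum>j\<in>block m. 2 * ?r m)"
      proof (intro sum.cong refl)
        fix j assume "j \<in> block m"
        hence "\<bar>\<epsilon> j\<bar> = 1" using sq power2_eq_1_iff[of "\<epsilon> j"] by auto
        thus "\<bar>2 * ?r m * \<epsilon> j\<bar> = 2 * ?r m" using amplitude_nonneg[of b] b by (simp add: abs_mult)
      qed
      also have "\<dots> \<le> 1" using amplitude_sum_le[of b "s m" m] b s_half[OF m] by simp
      finally show "(\<Sum>j\<in>(case i of (m, \<epsilon>) \<Rightarrow> block m). \<bar>?u i j\<bar>) \<le> 1" by (simp add: i)
      show "(case i of (m, \<epsilon>) \<Rightarrow> aa (s m)) \<in> \<A>" using aa(1)[OF M(2)[OF m]] by (simp add: i)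
      have "(\<Sum>j\<in>block m. (2 * ?r m * \<epsilon> j)\<^sup>2 / (aa (s m) j)\<^sup>2) \<le> 4 * b * 4 powr s_hi"
        using b s_half[OF m] by (intro block_ellipsoid_le sq aa(2)[OF M(2)[OF m]]) auto
      also have "\<dots> \<le> 2 * R\<^sup>2" using b(3) by (simp add: field_simps)
      finally show "(\<Sum>j\<in>(case i of (m, \<epsilon>) \<Rightarrow> block m). (?u i j)\<^sup>2 / ((case i of (m, \<epsilon>) \<Rightarrow> aa (s m)) j)\<^sup>2)
          \<le> 2 * R\<^sup>2" by (simp add: i)
      have "A * rho \<phi> (aa (s m)) y \<le> Abar * sqrt (D * 2 powr - (2 * real m * s m))"
        using A unfolding D_def
        by (intro mult_mono rho_block_le[OF c(1) p densities_integrable[OF phi_dens] lb aa(2)[OF M(2)[OF m]] M(3)[OF m]])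
           (auto intro: rho_nonneg)
      also have "\<dots> = sqrt (2 * b * 2 powr - (2 * real m * s m))"
        using D by (simp add: Abar_def real_sqrt_mult[symmetric])
      also have "\<dots> = sqrt (\<Sum>j\<in>block m. (2 * ?r m * \<epsilon> j)\<^sup>2 / 2)"
        using b sq by (subst block_L2) auto
      finally show "A * rho \<phi> (case i of (m, \<epsilon>) \<Rightarrow> aa (s m)) y \<le>
          sqrt (\<Sum>j\<in>(case i of (m, \<epsilon>) \<Rightarrow> block m). (?u i j)\<^sup>2 / 2)" by (simp add: i)
    next
      let ?c = "\<lambda>m m' j. 2 * (?r m * ?r m') * (?F j)\<^sup>2"
      have "(\<Sum>i\<in>M \<times> E. \<Sum>k\<in>M \<times> E.
            (1 + (\<Sum>j\<in>(case i of (m, \<epsilon>) \<Rightarrow> block m) \<inter> (case k of (m, \<epsilon>) \<Rightarrow> block m).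
               ?u i j * ?u k j * (?F j)\<^sup>2 / 2)) ^ n) =
          (\<Sum>(m, \<epsilon>)\<in>M \<times> E. \<Sum>(m', \<epsilon>')\<in>M \<times> E.
            (1 + (\<Sum>j\<in>block m \<inter> block m'. ?c m m' j * (\<epsilon> j * \<epsilon>' j))) ^ n)"
        by (simp add: case_prod_beta mult_ac)
      also have "\<dots> \<le> (2 ^ card J)\<^sup>2 * (N\<^sup>2 + N * exp (ln (ln (real n)) / 2))"
        unfolding N_def E_def
      proof (rule sum_mixture_le[OF fin])
        fix m assume m: "m \<in> M"
        show "block m \<subseteq> J" using m by (auto simp: J_def)
        \<comment> \<open>Since r \<le> 1 and \<bar>\<phi>_j\<bar> \<le> 1, the weights are at most
          2r, which reduces the claim to the nonnegativity estimate.\<close>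
        have "(\<Sum>j\<in>block m. ?c m m j) \<le> (\<Sum>j\<in>block m. 2 * ?r m)"
        proof (intro sum_mono)
          fix j
          have r: "0 \<le> ?r m" using b by (intro amplitude_nonneg) simp
          have "1 * (2 * ?r m) \<le> 2 ^ m * (2 * ?r m)" using r by (intro mult_right_mono) auto
          also have "\<dots> \<le> 1" using b s_half[OF m] by (intro amplitude_sum_le) auto
          finally have "?r m \<le> 1" by simp
          hence "?r m * ?r m \<le> ?r m" using r by (intro mult_left_le)
          moreover have "(?F j)\<^sup>2 \<le> 1" using cmod_fcoeff_le_1[OF phi_dens, of "int j"] by (simp add: power_le_one)
          ultimately have "(?r m * ?r m) * (?F j)\<^sup>2 \<le> ?r m * 1"
            using r by (intro mult_mono) (simp_all only: zero_le_power2)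
          thus "?c m m j \<le> 2 * ?r m" by simp
        qed
        also have "\<dots> \<le> 1" using amplitude_sum_le[of b "s m" m] b s_half[OF m] by simp
        finally show "(\<Sum>j\<in>block m. ?c m m j) \<le> 1" .
        have "(\<Sum>j\<in>block m. (real n * (2 * (?r m)\<^sup>2 * (?F j)\<^sup>2))\<^sup>2) \<le> 1 / (2 * (delta n)\<^sup>2)"
          using b ub block_ge_1 M(3)[OF m] delta by (intro block_chi_le[OF _ b(4) C p]) (auto simp: y_def)
        thus "(\<Sum>j\<in>block m. (real n * ?c m m j)\<^sup>2) \<le> ln (ln (real n)) / 2"
          using delta by (simp add: power2_eq_square)
      qed (use disjoint_block in auto)
      also have "exp (ln (ln (real n)) / 2) = sqrt (ln (real n))"
        using ln_pos by (simp add: powr_half_sqrt[symmetric] powr_def)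
      \<comment> \<open>The number of levels beats the cost sqrt (log n) of a single block by the
        factor \<alpha>^2.\<close>
      also have "(2 ^ card J)\<^sup>2 * (N\<^sup>2 + N * sqrt (ln (real n))) \<le> (2 ^ card J)\<^sup>2 * (N\<^sup>2 + N * (\<alpha>\<^sup>2 * N))"
        using N by (intro mult_left_mono add_left_mono) (auto simp: N_def)
      also have "\<dots> = (1 + \<alpha>\<^sup>2) * (real (card (M \<times> E)))\<^sup>2"
        using cardE by (simp add: card_cartesian_product N_def power2_eq_square algebra_simps)
      finally show "(\<Sum>i\<in>M \<times> E. \<Sum>k\<in>M \<times> E.
            (1 + (\<Sum>j\<in>(case i of (m, \<epsilon>) \<Rightarrow> block m) \<inter> (case k of (m, \<epsilon>) \<Rightarrow> block m).
               ?u i j * ?u k j * (?F j)\<^sup>2 / 2)) ^ n) \<le> (1 + \<alpha>\<^sup>2) * (real (card (M \<times> E)))\<^sup>2" .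
    qed
  qed
  thus "\<exists>n0::nat. \<exists>Abar::real. 0 < Abar \<and>
              (\<forall>n\<ge>n0. \<forall>A\<in>{0..Abar}.
                 (INF \<Delta>\<in>tests n. SUP a\<in>\<A>.
                    risk n \<phi> \<Delta> (ellipsoid a R) (A * rho \<phi> a (delta n * real n)))
                 \<ge> ennreal (1 - \<alpha>))"
    using Abar by blast
qed

end
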